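(* For every one-dimensional freezing cellular automaton $F$, the problem \textsc{AsyncUnstability} for $F$ belongs to the complexity class $\mathbf{NL}$ (nondeterministic logarithmic space).
   Context: A one-dimensional cellular automaton with finite state set $Q$ acts on configurations $x\in Q^{G(n)}$, where $G(n)$ is a set of $n$ cells arranged in a cycle (periodic boundary). Each cell $u$ has a neighborhood $N(u)$ consisting of the cells within a fixed finite radius of $u$ (including $u$), and a local function $f:Q^{N(\cdot)}\to Q$ defines the state update $f(x_{N(u)})$ of cell $u$. The automaton is freezing if there is a partial order $\le$ on $Q$ such that $x_u\le f(x_{N(u)})$ for all configurations $x$ and cells $u$ (states can only increase). A sequential (asynchronous) update scheme is a map $\sigma:\mathbb{N}\to G(n)$ such that for every $k\ge1$ the restriction of $\sigma$ to the $k$-th block of $|G(n)|$ consecutive time steps is a permutation of the cells. The dynamics is $F^{\sigma(0)}(x)=x$ and $F^{\sigma(t)}(x)_z=f(F^{\sigma(t-1)}(x)_{N(z)})$ if $z=\sigma(t)$, and $F^{\sigma(t)}(x)_z=F^{\sigma(t-1)}(x)_z$ otherwise (only one cell updated per step). \textsc{AsyncUnstability} for $F$: given a natural number $n$, a configuration $x\in Q^{G(n)}$ and a cell $u\in G(n)$, decide whether there exist a sequential update scheme $\sigma$ and $T>0$ such that $F^{\sigma(T)}(x)_u\neq x_u$. *)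

theory Defs
  imports Complex_Main "HOL-Library.Landau_Symbols"
begin

section \<open>Nondeterministic space-bounded Turing machines\<close>

text \<open>
  Off-line multitape machines: a two-way read-only input tape between end markers, and finitely
  many read/write work tapes. Work tapes are one-way infinite, with cells indexed by \<^typ>\<open>nat\<close>.
  States and work symbols are natural numbers, \<^term>\<open>0::nat\<close> being the blank; since the transition
  table is a finite set, only finitely many of them are ever used.
\<close>

datatype 'a input_symbol = Left_End | Right_End | Letter 'a

datatype move = Go_Left | Stay | Go_Right

text \<open>
  A transition \<open>(q, a, as, q', d, acts)\<close> applies in state \<open>q\<close> when the input head scans \<open>a\<close> and
  the \<open>i\<close>-th work head scans \<open>as ! i\<close>; it enters state \<open>q'\<close>, moves the input head by \<open>d\<close>, and on
  the \<open>i\<close>-th work tape writes the symbol and makes the move given by \<open>acts ! i\<close>.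
\<close>

type_synonym 'a transition =
  "nat \<times> 'a input_symbol \<times> nat list \<times> nat \<times> move \<times> (nat \<times> move) list"

record 'a ntm =
  num_tapes :: nat
  transitions :: "'a transition set"
  start_state :: nat
  accept_state :: nat

definition wf_ntm :: "'a ntm \<Rightarrow> bool" where
  "wf_ntm M \<longleftrightarrow> finite (transitions M) \<and>
     (\<forall>(q, a, as, q', d, acts) \<in> transitions M.
        length as = num_tapes M \<and> length acts = num_tapes M)"

text \<open>A work tape is given by its contents and its head position.\<close>

type_synonym work_tape = "(nat \<Rightarrow> nat) \<times> nat"

text \<open>State, input head position, work tapes.\<close>

type_synonym ntm_config = "nat \<times> nat \<times> work_tape list"

text \<open>The input letters occupy positions \<open>1, \<dots>, length w\<close>.\<close>

definition scan_input :: "'a list \<Rightarrow> nat \<Rightarrow> 'a input_symbol" where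
  "scan_input w i =
     (if i = 0 then Left_End else if i \<le> length w then Letter (w ! (i - 1)) else Right_End)"

text \<open>A left move at position 0 leaves the head where it is.\<close>

fun move_head :: "move \<Rightarrow> nat \<Rightarrow> nat" where
  "move_head Go_Left p = p - 1"
| "move_head Stay p = p"
| "move_head Go_Right p = p + 1"

fun work_action :: "nat \<times> move \<Rightarrow> work_tape \<Rightarrow> work_tape" where
  "work_action (b, d) (t, h) = (t(h := b), move_head d h)"

inductive ntm_step :: "'a ntm \<Rightarrow> 'a list \<Rightarrow> ntm_config \<Rightarrow> ntm_config \<Rightarrow> bool"
  for M :: "'a ntm" and w :: "'a list" where
  "(q, scan_input w i, map (\<lambda>(t, h). t h) ts, q', d, acts) \<in> transitions M \<Longrightarrow>
   ntm_step M w (q, i, ts) (q', min (move_head d i) (length w + 1), map2 work_action acts ts)"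

definition initial_config :: "'a ntm \<Rightarrow> ntm_config" where
  "initial_config M = (start_state M, 0, replicate (num_tapes M) (\<lambda>_. 0, 0))"

definition reachable :: "'a ntm \<Rightarrow> 'a list \<Rightarrow> ntm_config \<Rightarrow> bool" where
  "reachable M w c \<longleftrightarrow> (ntm_step M w)\<^sup>*\<^sup>* (initial_config M) c"

definition accepts :: "'a ntm \<Rightarrow> 'a list \<Rightarrow> bool" where
  "accepts M w \<longleftrightarrow> (\<exists>i ts. reachable M w (accept_state M, i, ts))"

text \<open>
  Heads start in cell 0, so a computation visits at most \<open>m\<close> cells of a work tape iff the head on
  that tape always stays at positions below \<open>m\<close>. The bound is imposed on all computation paths.
\<close>

definition space_bounded :: "'a ntm \<Rightarrow> (nat \<Rightarrow> nat) \<Rightarrow> bool" where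
  "space_bounded M s \<longleftrightarrow>
     (\<forall>w q i ts. reachable M w (q, i, ts) \<longrightarrow> (\<forall>(t, h) \<in> set ts. h < s (length w)))"

definition NSPACE :: "(nat \<Rightarrow> nat) \<Rightarrow> 'a::finite list set set" where
  "NSPACE s = {A. \<exists>M. wf_ntm M \<and> space_bounded M s \<and> A = {w. accepts M w}}"

definition NL :: "'a::finite list set set" where
  "NL = (\<Union>s \<in> {s. (\<lambda>n. real (s n)) \<in> O(\<lambda>n. ln (real n))}. NSPACE s)"


section \<open>One-dimensional cellular automata\<close>

text \<open>
  Only the values of the local function on lists of length \<open>2 * radius + 1\<close> are relevant.
\<close>

record 'q ca =
  radius :: nat
  local_fun :: "'q list \<Rightarrow> 'q"

text \<open>
  A configuration on the cycle with cells \<open>0, \<dots>, n - 1\<close> is a list of length \<open>n\<close>. The neighborhood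
  of a cell is read from left to right with indices modulo \<open>n\<close>.
\<close>

definition neighborhood :: "'q ca \<Rightarrow> 'q list \<Rightarrow> nat \<Rightarrow> 'q list" where
  "neighborhood F x u =
     map (\<lambda>i. x ! nat ((int u + i) mod int (length x))) [- int (radius F)..int (radius F)]"

definition freezing :: "'q ca \<Rightarrow> bool" where
  "freezing F \<longleftrightarrow> (\<exists>le. reflp le \<and> antisymp le \<and> transp le \<and>
     (\<forall>x u. u < length x \<longrightarrow> le (x ! u) (local_fun F (neighborhood F x u))))"

text \<open>The steps of the dynamics are numbered from 1, hence so are the blocks; \<open>\<sigma> 0\<close> is not used.\<close>

definition sequential_scheme :: "nat \<Rightarrow> (nat \<Rightarrow> nat) \<Rightarrow> bool" where
  "sequential_scheme n \<sigma> \<longleftrightarrow> (\<forall>t. \<sigma> t < n) \<and>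
     (\<forall>k\<ge>1. bij_betw \<sigma> {(k - 1) * n + 1..k * n} {..<n})"

primrec async_run :: "'q ca \<Rightarrow> (nat \<Rightarrow> nat) \<Rightarrow> 'q list \<Rightarrow> nat \<Rightarrow> 'q list" where
  "async_run F \<sigma> x 0 = x"
| "async_run F \<sigma> x (Suc t) =
     (async_run F \<sigma> x t)
       [\<sigma> (Suc t) := local_fun F (neighborhood F (async_run F \<sigma> x t) (\<sigma> (Suc t)))]"


section \<open>The decision problem\<close>

datatype 'q symbol = Bit bool | Separator | State 'q

instance symbol :: (finite) finite
proof
  have "x \<in> range Bit \<union> {Separator} \<union> range State" for x :: "'a symbol"
    by (cases x) simp_all
  then have "(UNIV :: 'a symbol set) \<subseteq> range Bit \<union> {Separator} \<union> range State"
    by blast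
  then show "finite (UNIV :: 'a symbol set)"
    by (rule finite_subset) simp
qed

text \<open>Binary notation, most significant bit first.\<close>

fun binary :: "nat \<Rightarrow> bool list" where
  "binary n = (if n < 2 then [n = 1] else binary (n div 2) @ [odd n])"

declare binary.simps [simp del]

definition encode_instance :: "nat \<Rightarrow> 'q list \<Rightarrow> nat \<Rightarrow> 'q symbol list" where
  "encode_instance n x u =
     map Bit (binary n) @ [Separator] @ map State x @ [Separator] @ map Bit (binary u)"

definition AsyncUnstability :: "'q ca \<Rightarrow> 'q symbol list set" where
  "AsyncUnstability F = {encode_instance n x u | n x u. length x = n \<and> u < n \<and>
     (\<exists>\<sigma> T. sequential_scheme n \<sigma> \<and> T > 0 \<and> async_run F \<sigma> x T ! u \<noteq> x ! u)}"

end

theory Submission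
  imports Defs "HOL-Library.Nat_Bijection"
begin

text \<open>
  In a run of a freezing automaton every cell enters each state at most once, so its whole history
  is described by boundedly many pairs (block, position inside the block). An update that changes
  nothing is invisible to the other cells, hence whether the histories of all cells come from a
  common update scheme can be checked separately for each window of \<open>2 * radius + 1\<close> cells: in every
  block the central cell must have some moment at which its update has the recorded effect, and
  neighbouring cells must not change at the same moment. Moreover a block without any change
  is followed by no change at all, so the block numbers are at most \<open>n * |Q|\<close> and take
  logarithmic space. A nondeterministic machine therefore guesses the histories while sliding a
  window over the configuration, keeping a copy of the first window to close the cycle.

  All that this machine ever does to its registers is to guess values, and to compare, double and
  increment them. Such relations are recognised by finite automata that read the digits
  starting with the least significant one, so that a Turing machine performs a step of the register
  machine in a single sweep over its work tape.
\<close>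

section \<open>Sweeping Turing machines\<close>

text \<open>A scheme orders all cells of the cycle, while a window sees only
  \<open>2 * radius + 1\<close> of them. The certificates fix the order only of updates that change
  something. Every other update has a moment chosen by its own window, and different windows choose
  independently. The choices are merged by sorting on doubled keys, odd for a change and even for an
  idle update: a change and an idle update then never tie, and the remaining ties are harmless.

  The moments of idle updates, and the blocks in which a window is quiet, range over infinitely many
  values. Only their order relative to the recorded times matters, so one representative per gap
  suffices: 0, a recorded value, or the successor of one. This is what keeps the check within
  comparisons and increments.

  Cell numbers are stored next to the histories because on a cycle shorter than the window one cell
  fills several slots.

  The space bound concerns all computation paths, so a guess must not be able to overflow. Hence the
  input length is counted in binary beforehand, and every later guess merely overwrites a word of
  that fixed length.\<close>

fun chain :: "('s \<Rightarrow> 'c \<Rightarrow> 'c \<Rightarrow> bool) \<Rightarrow> 's list \<Rightarrow> 'c \<Rightarrow> 'c \<Rightarrow> bool" where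
  "chain R [] x y \<longleftrightarrow> x = y"
| "chain R (a # as) x z \<longleftrightarrow> (\<exists>y. R a x y \<and> chain R as y z)"

lemma chain_append: "chain R (as @ bs) x z \<longleftrightarrow> (\<exists>y. chain R as x y \<and> chain R bs y z)"
  by (induction as arbitrary: x) auto

section \<open>Binary counters, least significant bit first\<close>

fun increment :: "nat list \<Rightarrow> nat list" where
  "increment [] = [1]"
| "increment (c # cs) = (if c = 0 then 1 # cs else 0 # increment cs)"

text \<open>No zeros appear at the significant end, so the length is that of the binary notation;
  \<open>counter 0\<close> is the empty word.\<close>

definition counter :: "nat \<Rightarrow> nat list" where
  "counter n = (increment ^^ n) []"

lemma counter_Suc: "counter (Suc n) = increment (counter n)"
  by (simp add: counter_def)

lemma set_increment: "set cs \<subseteq> {0, 1} \<Longrightarrow> set (increment cs) \<subseteq> {0, 1}"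
  by (induction cs) auto

lemma set_counter: "set (counter n) \<subseteq> {0, 1}"
proof (induction n)
  case (Suc n)
  then show ?case unfolding counter_Suc by (rule set_increment)
qed (simp add: counter_def)

lemma length_increment: "length cs \<le> length (increment cs)"
  by (induction cs) auto

lemma length_counter_mono: "m \<le> n \<Longrightarrow> length (counter m) \<le> length (counter n)"
  by (induction n rule: dec_induct) (auto simp: counter_Suc intro: order_trans length_increment)

fun binval :: "nat list \<Rightarrow> nat" where
  "binval [] = 0"
| "binval (c # cs) = c + 2 * binval cs"

lemma binval_increment: "set cs \<subseteq> {0, 1} \<Longrightarrow> binval (increment cs) = Suc (binval cs)"
  by (induction cs) auto

lemma binval_counter: "binval (counter n) = n"
proof (induction n)
  case (Suc n)
  then show ?case by (metis binval_increment counter_Suc set_counter)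
qed (simp add: counter_def)

lemma binval_less: "set cs \<subseteq> {0, 1} \<Longrightarrow> binval cs < 2 ^ length cs"
  by (induction cs) auto

lemma less_power_length_counter: "n < 2 ^ length (counter n)"
  using binval_less[OF set_counter[of n]] by (simp add: binval_counter)

lemma last_increment: "cs = [] \<or> last cs = 1 \<Longrightarrow> last (increment cs) = 1 \<and> increment cs \<noteq> []"
  by (induction cs) (auto split: if_splits)

lemma last_counter: "counter n = [] \<or> last (counter n) = 1"
proof (induction n)
  case (Suc n)
  from last_increment[OF this] show ?case by (simp add: counter_Suc)
qed (simp add: counter_def)

lemma binval_ge: "cs \<noteq> [] \<Longrightarrow> last cs = 1 \<Longrightarrow> 2 ^ length cs \<le> 2 * binval cs"
  by (induction cs) (auto split: if_splits)

lemma power_length_counter_le: "0 < n \<Longrightarrow> 2 ^ length (counter n) \<le> 2 * n"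
  using binval_ge[of "counter n"] last_counter[of n] binval_counter[of n] by (cases "counter n =
    []") auto

lemma length_counter_bigo: "(\<lambda>n. real (length (counter n) + 2)) \<in> O(\<lambda>n. ln (real n))"
proof (rule bigoI[where c = "1 / ln 2 + 3 / ln 2"])
  show "\<forall>\<^sub>F n in sequentially. norm (real (length (counter n) + 2))
      \<le> (1 / ln 2 + 3 / ln 2) * norm (ln (real n))"
    using eventually_ge_at_top[of 2]
  proof eventually_elim
    case (elim n)
    have "real (2 ^ length (counter n)) \<le> real (2 * n)"
      using power_length_counter_le[of n] elim by (intro of_nat_mono) simp
    then have "ln (2 ^ length (counter n)) \<le> ln (2 * real n)"
      using elim by (subst ln_le_cancel_iff) auto
    then have 1: "length (counter n) * ln 2 \<le> ln 2 + ln (real n)"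
      using elim by (simp add: ln_mult ln_realpow)
    have 2: "ln 2 \<le> ln (real n)" using elim by simp
    \<comment> \<open>Fact 1 and the two extra cells give \<open>ln n + 3 * ln 2\<close>, and
      \<open>ln 2\<close> is at most \<open>ln n\<close>.\<close>
    from 1 2 have "(length (counter n) + 2) * ln 2 \<le> 4 * ln (real n)"
      by (simp add: algebra_simps)
    then have "real (length (counter n) + 2) \<le> 4 * ln (real n) / ln 2"
      by (simp add: pos_le_divide_eq)
    also have "\<dots> = (1 / ln 2 + 3 / ln 2) * ln (real n)" by (simp add: field_simps)
    finally have "real (length (counter n) + 2) \<le> (1 / ln 2 + 3 / ln 2) * ln (real n)" .
    moreover have "norm (ln (real n)) = ln (real n)" using elim by simp
    moreover have "norm (real (length (counter n) + 2)) = real (length (counter n) + 2)" by simp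
    ultimately show ?case by (simp only:)
  qed
qed

text \<open>Cell 0 holds an end marker, coded 1; the letter \<open>c\<close> is coded \<open>c + 2\<close>, and 0 is the blank.\<close>

definition tape_of :: "nat list \<Rightarrow> nat \<Rightarrow> nat" where
  "tape_of cs j = (if j = 0 then 1 else if j \<le> length cs then cs ! (j - 1) + 2 else 0)"

lemma tape_of_simps:
  "tape_of cs 0 = Suc 0"
  "tape_of (cs @ c # ds) (Suc (length cs)) = c + 2"
  "tape_of cs (Suc (length cs)) = 0"
  by (auto simp: tape_of_def)

lemma tape_of_update:
  "(tape_of cs)(0 := Suc 0) = tape_of cs"
  "(tape_of (cs @ c # ds))(Suc (length cs) := d + 2) = tape_of (cs @ d # ds)"
  "(tape_of cs)(Suc (length cs) := d + 2) = tape_of (cs @ [d])"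
  "(tape_of cs)(Suc (length cs) := 0) = tape_of cs"
  by (auto simp: tape_of_def fun_eq_iff nth_append nth_Cons' not_less less_Suc_eq_le)

text \<open>The counting rules write the literals 2 and 3, the codes of the digits 0 and 1, instead
  of a term \<open>d + 2\<close>.\<close>

lemma tape_of_update_digit:
  "(tape_of (cs @ c # ds))(Suc (length cs) := 2) = tape_of (cs @ 0 # ds)"
  "(tape_of (cs @ c # ds))(Suc (length cs) := 3) = tape_of (cs @ Suc 0 # ds)"
  "(tape_of cs)(Suc (length cs) := 3) = tape_of (cs @ [Suc 0])"
  using tape_of_update(2)[of cs c ds 0] tape_of_update(2)[of cs c ds 1] tape_of_update(3)[of cs 1]
  by (simp_all add: numeral_2_eq_2 numeral_3_eq_3)

lemma finite_input_symbol: "finite (UNIV :: 'a::finite input_symbol set)"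
proof -
  have "x \<in> range Letter \<union> {Left_End, Right_End}" for x :: "'a input_symbol"
    by (cases x) auto
  then have "(UNIV :: 'a input_symbol set) \<subseteq> range Letter \<union> {Left_End, Right_End}"
    by blast
  then show ?thesis by (rule finite_subset) simp
qed

definition symbols :: "'a list \<Rightarrow> 'a input_symbol list" where
  "symbols w = Left_End # map Letter w @ [Right_End]"

lemma length_symbols: "length (symbols w) = length w + 2"
  by (simp add: symbols_def)

lemma nth_symbols: "i \<le> length w + 1 \<Longrightarrow> symbols w ! i = scan_input w i"
  by (auto simp: symbols_def scan_input_def nth_append nth_Cons')

text \<open>For each input symbol \<open>a\<close> there is a deterministic automaton over pairs of
  an old and a new tape letter, that is, a letter-to-letter relation between the tape word before
  and after the sweep. All of them share the state set \<open>S\<close>.\<close>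

locale sweeping =
  fixes A :: nat and S :: "nat set"
    and \<delta> :: "'a::finite input_symbol \<Rightarrow> nat \<Rightarrow> nat \<Rightarrow> nat \<Rightarrow> nat"
    and s0 :: "'a input_symbol \<Rightarrow> nat"
    and Acc :: "'a input_symbol \<Rightarrow> nat set"
  assumes A_ge: "2 \<le> A" and finite_S: "finite S" and s0_in: "s0 a \<in> S"
    and \<delta>_in: "s \<in> S \<Longrightarrow> c < A \<Longrightarrow> c' < A \<Longrightarrow> \<delta> a s c c' \<in> S"
begin

text \<open>
  In states 0 to 2 the machine increments a binary counter once per input letter, which marks off
  logarithmically many cells. State 3 brings the input head back to the left end. Then, for each
  input symbol, a sweep in the states \<open>6 + s\<close> guesses the new word letter by letter while running
    the
  automaton for this symbol; state 4 returns to the end marker, and state 5 accepts.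
\<close>

inductive rule :: "'a transition \<Rightarrow> bool" where
  start: "rule (0, Left_End, [0], 1, Go_Right, [(1, Go_Right)])"
| carry: "rule (1, Letter a, [3], 1, Stay, [(2, Go_Right)])"
| inc: "c \<in> {0, 2} \<Longrightarrow> rule (1, Letter a, [c], 2, Stay, [(3, Go_Left)])"
| counted: "c \<in> {0, 2, 3} \<Longrightarrow> rule (1, Right_End, [c], 3, Stay, [(c, Go_Left)])"
| go_back: "c \<in> {2, 3} \<Longrightarrow> rule (2, Letter a, [c], 2, Stay, [(c, Go_Left)])"
| advance: "rule (2, Letter a, [1], 1, Go_Right, [(1, Go_Right)])"
| rewind: "b \<noteq> Left_End \<Longrightarrow> rule (3, b, [1], 3, Go_Left, [(1, Stay)])"
| rewound: "rule (3, Left_End, [1], 6 + s0 Left_End, Stay, [(1, Go_Right)])"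
| sweep: "s \<in> S \<Longrightarrow> c < A \<Longrightarrow> c' < A \<Longrightarrow>
    rule (6 + s, b, [c + 2], 6 + \<delta> b s c c', Stay, [(c' + 2, Go_Right)])"
| swept: "s \<in> S \<Longrightarrow> s \<in> Acc b \<Longrightarrow> b \<noteq> Right_End \<Longrightarrow>
    rule (6 + s, b, [0], 4, Go_Right, [(0, Go_Left)])"
| finish: "s \<in> S \<Longrightarrow> s \<in> Acc Right_End \<Longrightarrow>
    rule (6 + s, Right_End, [0], 5, Stay, [(0, Stay)])"
| return: "c < A \<Longrightarrow> rule (4, b, [c + 2], 4, Stay, [(c + 2, Go_Left)])"
| returned: "rule (4, b, [1], 6 + s0 b, Stay, [(1, Go_Right)])"

definition machine :: "'a ntm" where
  "machine = \<lparr>num_tapes = 1, transitions = {tr. rule tr}, start_state = 0, accept_state = 5\<rparr>"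

lemma rule_finite: "finite {tr. rule tr}"
proof -
  obtain m where m: "s < m" if "s \<in> S" for s
    using finite_S[unfolded finite_nat_set_iff_bounded] by auto
  let ?Q = "{..<6 + m}" and ?C = "{..<A + 2}" and ?D = "{Go_Left, Stay, Go_Right}"
  let ?T = "?Q \<times> (UNIV :: 'a input_symbol set) \<times> {as. set as \<subseteq> ?C \<and> length as = 1} \<times> ?Q \<times> ?D \<times>
    {acts. set acts \<subseteq> ?C \<times> ?D \<and> length acts = 1}"
  have s0: "s0 a < m" for a using m s0_in by blast
  have "tr \<in> ?T" if "rule tr" for tr
    using that
  proof cases
    case (sweep s c c' b)
    then show ?thesis using m[OF \<delta>_in[of s c c' b]] m[of s] by simp
  next
    case (swept s b)
    then show ?thesis using m[of s] by simp
  next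
    case (finish s)
    then show ?thesis using m[of s] by simp
  qed (use A_ge s0 in simp_all, (elim disjE; simp)+)
  then have "{tr. rule tr} \<subseteq> ?T" by blast
  moreover have "finite ?T"
    by (intro finite_cartesian_product finite_lists_length_eq finite_input_symbol) simp_all
  ultimately show ?thesis by (rule finite_subset)
qed

lemma rule_lengths: "rule (q, a, as, q', d, acts) \<Longrightarrow> length as = 1 \<and> length acts = 1"
  by (erule rule.cases) simp_all

lemma wf_machine: "wf_ntm machine"
  unfolding wf_ntm_def machine_def using rule_finite by (auto dest: rule_lengths)

fun run_dfa :: "'a input_symbol \<Rightarrow> nat \<Rightarrow> nat list \<Rightarrow> nat list \<Rightarrow> nat" where
  "run_dfa a s (c # cs) (c' # cs') = run_dfa a (\<delta> a s c c') cs cs'"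
| "run_dfa a s _ _ = s"

definition word_step :: "'a input_symbol \<Rightarrow> nat list \<Rightarrow> nat list \<Rightarrow> bool" where
  "word_step a W W' \<longleftrightarrow> length W = length W' \<and> set W \<subseteq> {..<A} \<and> set W' \<subseteq> {..<A} \<and>
     run_dfa a (s0 a) W W' \<in> Acc a"

lemma run_dfa_append:
  "length cs = length cs' \<Longrightarrow>
    run_dfa a s (cs @ ds) (cs' @ ds') = run_dfa a (run_dfa a s cs cs') ds ds'"
  by (induction cs cs' arbitrary: s rule: list_induct2) auto

lemma run_dfa_in:
  "length cs = length cs' \<Longrightarrow> set cs \<subseteq> {..<A} \<Longrightarrow> set cs' \<subseteq> {..<A} \<Longrightarrow> s \<in> S \<Longrightarrow> run_dfa a s cs cs' \<in> S"
  by (induction cs cs' arbitrary: s rule: list_induct2) (auto simp: \<delta>_in)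

text \<open>With a single work tape the list of tapes can be flattened away; \<open>conf\<close>
  restores it and \<open>reachable_iff\<close> transfers reachability.\<close>

definition step1 :: "'a list \<Rightarrow> nat \<times> nat \<times> (nat \<Rightarrow> nat) \<times> nat \<Rightarrow> nat \<times> nat \<times> (nat \<Rightarrow> nat) \<times> nat \<Rightarrow>
  bool" where
  "step1 w = (\<lambda>(q, i, t, h) (q', i', t', h'). \<exists>d b e. rule (q, scan_input w i, [t h], q', d, [(b,
    e)]) \<and>
     i' = min (move_head d i) (length w + 1) \<and> t' = t(h := b) \<and> h' = move_head e h)"

abbreviation conf :: "nat \<times> nat \<times> (nat \<Rightarrow> nat) \<times> nat \<Rightarrow> ntm_config" where
  "conf \<equiv> (\<lambda>(q, i, t, h). (q, i, [(t, h)]))"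

lemma ntm_step_confD:
  assumes "ntm_step machine w (conf c) c'"
  shows "\<exists>d. c' = conf d \<and> step1 w c d"
proof -
  obtain q i t h where c: "c = (q, i, t, h)" by (cases c)
  from assms obtain q' d acts where r: "rule (q, scan_input w i, [t h], q', d, acts)"
    "c' = (q', min (move_head d i) (length w + 1), map2 work_action acts [(t, h)])"
    by (auto simp: ntm_step.simps machine_def c)
  obtain b e where "acts = [(b, e)]"
    using rule_lengths[OF r(1)] by (cases acts) auto
  with r have "c' = conf (q', min (move_head d i) (length w + 1), t(h := b), move_head e h)"
    "step1 w c (q', min (move_head d i) (length w + 1), t(h := b), move_head e h)"
    by (auto simp: step1_def c)
  then show ?thesis by blast
qed

lemma ntm_step_confI:
  assumes "step1 w c d"
  shows "ntm_step machine w (conf c) (conf d)"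
proof -
  obtain q i t h where c: "c = (q, i, t, h)" by (cases c)
  from assms obtain q' m b e where "rule (q, scan_input w i, [t h], q', m, [(b, e)])"
    "d = (q', min (move_head m i) (length w + 1), t(h := b), move_head e h)"
    by (cases d) (auto simp: step1_def c)
  then show ?thesis
    using ntm_step.intros[of q w i "[(t, h)]" q' m "[(b, e)]" machine] by (simp add: machine_def c)
qed

lemma reachable_iff:
  "reachable machine w c \<longleftrightarrow> (\<exists>d. c = conf d \<and> (step1 w)\<^sup>*\<^sup>* (0, 0, \<lambda>_. 0, 0) d)"
proof -
  have 1: "\<exists>d. c = conf d \<and> (step1 w)\<^sup>*\<^sup>* d0 d" if "(ntm_step machine w)\<^sup>*\<^sup>* (conf d0) c" for d0
    using that
  proof (induction rule: rtranclp_induct)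
    case (step y z)
    then obtain d where d: "y = conf d" "(step1 w)\<^sup>*\<^sup>* d0 d" by blast
    from ntm_step_confD[of w d z] step(2) d(1) obtain d' where "z = conf d'" "step1 w d d'" by blast
    with rtranclp.rtrancl_into_rtrancl[OF d(2)] show ?case by blast
  qed blast
  have 2: "(ntm_step machine w)\<^sup>*\<^sup>* (conf d0) (conf d)" if "(step1 w)\<^sup>*\<^sup>* d0 d" for d0 d
    using that
  proof (induction rule: rtranclp_induct)
    case (step y z)
    from rtranclp.rtrancl_into_rtrancl[OF step(3) ntm_step_confI[OF step(2)]] show ?case .
  qed (rule rtranclp.rtrancl_refl)
  have "initial_config machine = conf (0, 0, \<lambda>_. 0, 0)"
    by (simp add: initial_config_def machine_def)
  then have R: "reachable machine w c \<longleftrightarrow> (ntm_step machine w)\<^sup>*\<^sup>* (conf (0, 0, \<lambda>_. 0, 0)) c"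
    by (simp only: reachable_def)
  show ?thesis
  proof
    assume "\<exists>d. c = conf d \<and> (step1 w)\<^sup>*\<^sup>* (0, 0, \<lambda>_. 0, 0) d"
    then obtain d where d: "c = conf d" "(step1 w)\<^sup>*\<^sup>* (0, 0, \<lambda>_. 0, 0) d" by blast
    show "reachable machine w c" unfolding R unfolding d(1) by (rule 2[OF d(2)])
  qed (unfold R, rule 1)
qed

section \<open>An invariant of all reachable configurations\<close>

lemma chain_word_step:
  "chain word_step as W W' \<Longrightarrow> set W \<subseteq> {..<A} \<Longrightarrow> length W' = length W \<and> set W' \<subseteq> {..<A}"
proof (induction as arbitrary: W)
  case (Cons a as)
  then obtain V where "word_step a W V" "chain word_step as V W'" by auto
  then show ?case using Cons.IH[of V] unfolding word_step_def[of a] by simp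
qed simp

text \<open>The words that the tape may hold when symbol number \<open>i\<close> is about to be
  processed; the first one is the counter left by the counting pass.\<close>

abbreviation reach :: "'a list \<Rightarrow> nat \<Rightarrow> nat list \<Rightarrow> bool" where
  "reach w i \<equiv> chain word_step (take i (symbols w)) (counter (length w))"

lemma counter_letters: "set (counter n) \<subseteq> {..<A}"
  using set_counter[of n] A_ge by force

lemma reach_letters: "reach w i W \<Longrightarrow> length W = length (counter (length w)) \<and> set W \<subseteq> {..<A}"
  using chain_word_step counter_letters by blast

lemma reach_Suc:
  assumes "i \<le> length w + 1"
  shows "reach w (Suc i) W' \<longleftrightarrow> (\<exists>W. reach w i W \<and> word_step (scan_input w i) W W')"
proof -
  have "take (Suc i) (symbols w) = take i (symbols w) @ [scan_input w i]"
    using assms by (simp add: take_Suc_conv_app_nth length_symbols nth_symbols)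
  then show ?thesis by (simp add: chain_append)
qed

text \<open>Serves both for the space bound and for the soundness of acceptance. In
  \<open>inv_inc\<close> a carry has already cleared \<open>m\<close> ones; at the right end
  \<open>m = 0\<close>, so counting ends with an intact counter. In \<open>inv_sweep\<close> the
  letters \<open>cs\<close> are already overwritten by \<open>cs'\<close> and survive only in the
  automaton state \<open>s\<close>.\<close>

inductive invariant :: "'a list \<Rightarrow> nat \<times> nat \<times> (nat \<Rightarrow> nat) \<times> nat \<Rightarrow> bool" for w where
  inv_start: "invariant w (0, 0, \<lambda>_. 0, 0)"
| inv_inc: "1 \<le> i \<Longrightarrow> i \<le> length w + 1 \<Longrightarrow> counter (i - 1) = replicate m 1 @ ds \<Longrightarrow>
    (i = length w + 1 \<Longrightarrow> m = 0) \<Longrightarrow> invariant w (1, i, tape_of (replicate m 0 @ ds), Suc m)"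
| inv_back: "1 \<le> i \<Longrightarrow> i \<le> length w \<Longrightarrow> h \<le> length (counter i) \<Longrightarrow> invariant w (2, i, tape_of (counter
  i), h)"
| inv_rewind: "i \<le> length w + 1 \<Longrightarrow> invariant w (3, i, tape_of (counter (length w)), 0)"
| inv_return: "i \<le> length w + 1 \<Longrightarrow> reach w i W \<Longrightarrow> h \<le> length W \<Longrightarrow> invariant w (4, i, tape_of W, h)"
| inv_sweep: "i \<le> length w + 1 \<Longrightarrow> reach w i (cs @ ds) \<Longrightarrow> length cs' = length cs \<Longrightarrow> set cs' \<subseteq> {..<A} \<Longrightarrow>
    s = run_dfa (scan_input w i) (s0 (scan_input w i)) cs cs' \<Longrightarrow>
    invariant w (6 + s, i, tape_of (cs' @ ds), Suc (length cs))"
| inv_accept: "h \<le> length (counter (length w)) + 1 \<Longrightarrow> reach w (length w + 2) W \<Longrightarrow> invariant w (5, i,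
  t, h)"

lemma increment_carry: "increment (replicate m 1 @ ds) = replicate m 0 @ increment ds"
  by (induction m) auto

lemma tape_of_letter: "0 < h \<Longrightarrow> h \<le> length W \<Longrightarrow> tape_of W h \<in> (+) 2 ` set W"
  by (auto simp: tape_of_def)

lemma tape_of_eq_1: "tape_of W h = Suc 0 \<longleftrightarrow> h = 0"
  by (auto simp: tape_of_def)

lemma scan_input_Left_End: "scan_input w i = Left_End \<longleftrightarrow> i = 0"
  by (simp add: scan_input_def)

lemma scan_input_Right_End: "i \<le> length w + 1 \<Longrightarrow> scan_input w i = Right_End \<longleftrightarrow> i = length w + 1"
  by (auto simp: scan_input_def)

lemma scan_input_Letter: "scan_input w i = Letter a \<Longrightarrow> 1 \<le> i \<and> i \<le> length w"
  by (auto simp: scan_input_def split: if_splits)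

lemma inv_step:
  assumes "invariant w c" "step1 w c c'"
  shows "invariant w c'"
proof -
  obtain q i t h where c: "c = (q, i, t, h)" by (cases c)
  obtain d b e q' where r: "rule (q, scan_input w i, [t h], q', d, [(b, e)])"
    and c': "c' = (q', min (move_head d i) (length w + 1), t(h := b), move_head e h)"
    using assms(2) unfolding step1_def c by (cases c') auto
  show ?thesis
    using assms(1)[unfolded c]
  proof cases
    case inv_start
    have *: "(\<lambda>_. 0)(0 := 1) = tape_of []" by (auto simp: tape_of_def)
    from r show ?thesis
    proof cases
      case start
      then show ?thesis using inv_inc[of 1 w 0 "[]"] inv_start
        by (simp add: c' * [simplified] counter_def)
    qed (use inv_start in auto)
  next
    case (inv_inc m ds)
    have *: "tape_of (replicate m 0 @ ds) (Suc m) = (if ds = [] then 0 else hd ds + 2)"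
      by (cases ds) (use tape_of_simps(3)[of "replicate m 0"] tape_of_simps(2)[of "replicate m 0"]
        in auto)
    from r show ?thesis
    proof cases
      case (carry a)
      then obtain ds' where ds: "ds = 1 # ds'"
        using * inv_inc by (cases ds) auto
      have 1: "t(h := b) = tape_of (replicate (Suc m) 0 @ ds')"
        using tape_of_update_digit(1)[of "replicate m 0" 1 ds'] inv_inc carry
        by (simp add: ds replicate_app_Cons_same)
      have "invariant w (1, i, tape_of (replicate (Suc m) 0 @ ds'), Suc (Suc m))"
        using inv_inc scan_input_Letter[of w i a] carry
        by (intro invariant.inv_inc) (auto simp: ds replicate_app_Cons_same)
      then show ?thesis using carry inv_inc 1 by (simp add: c')
    next
      case (inc a)
      have "counter i = increment (replicate m 1 @ ds)" using inv_inc counter_Suc[of "i - 1"] by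
        simp
      then have ci: "counter i = replicate m 0 @ increment ds" by (simp only: increment_carry)
      have "t(h := b) = tape_of (counter i) \<and> m \<le> length (counter i)"
      proof (cases ds)
        case Nil
        then show ?thesis
          using tape_of_update_digit(3)[of "replicate m 0"] inv_inc inc by (simp add: ci)
      next
        case (Cons x xs)
        then show ?thesis
          using tape_of_update_digit(2)[of "replicate m 0" x xs] inv_inc inc * by (simp add: ci)
      qed
      then show ?thesis using inc inv_inc scan_input_Letter[of w i a]
        by (auto simp: c' intro!: invariant.inv_back)
    next
      case counted
      then have "i = length w + 1" using scan_input_Right_End[of i w] inv_inc by simp
      then have "m = 0" "counter (length w) = ds" "i = length w + 1" using inv_inc by auto
      then show ?thesis using counted inv_inc
        by (auto simp: c' simp del: One_nat_def intro!: invariant.inv_rewind)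
    qed (use inv_inc in auto)
  next
    case inv_back
    note bk = this
    from r show ?thesis
    proof cases
      case (go_back a)
      then have "t(h := b) = t" by auto
      then show ?thesis using go_back bk by (auto simp: c' intro!: invariant.inv_back)
    next
      case (advance a)
      then have h: "h = 0" "t(h := b) = t" using bk by (auto simp: tape_of_eq_1
        tape_of_update[simplified])
      show ?thesis
        using inv_inc[of "Suc i" w 0 "counter i"] bk h advance by (simp add: c')
    qed (use bk in auto)
  next
    case inv_rewind
    note rw = this
    from r show ?thesis
    proof cases
      case rewind
      then show ?thesis using rw invariant.inv_rewind[of "i - 1" w] by (simp add: c' tape_of_update)
    next
      case rewound
      then have "i = 0" using scan_input_Left_End[of w i] by simp
      then show ?thesis using rw rewound invariant.inv_sweep[of 0 w "[]" "counter (length w)" "[]"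
        "s0 (scan_input w i)"]
        by (simp add: c' tape_of_update)
    qed (use rw in auto)
  next
    case (inv_return W)
    note ret = this
    from r show ?thesis
    proof cases
      case (return c)
      then have "t(h := b) = t" by auto
      then show ?thesis using return ret by (auto simp: c' intro!: invariant.inv_return)
    next
      case returned
      then have h: "h = 0" "t(h := b) = t" using ret by (auto simp: tape_of_eq_1
        tape_of_update[simplified])
      show ?thesis
        using invariant.inv_sweep[of i w "[]" W "[]" "s0 (scan_input w i)"] ret h returned by
          (simp add: c')
    qed (use ret in auto)
  next
    case (inv_sweep cs ds cs' s)
    note sw = this
    have L: "length (cs @ ds) = length (counter (length w))" "set (cs @ ds) \<subseteq> {..<A}"
      using reach_letters sw by blast+
    have h: "h = Suc (length cs')" using sw by simp
    have *: "t h = (if ds = [] then 0 else hd ds + 2)"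
      using sw tape_of_simps(2,3)[of cs'] by (cases ds) auto
    from r show ?thesis
    proof cases
      case (sweep s' c c')
      then obtain ds' where ds: "ds = c # ds'" using * by (cases ds) auto
      have "t(h := b) = tape_of ((cs' @ [c']) @ ds')"
        using sweep sw tape_of_update(2)[of cs' c ds' c'] by (simp add: ds)
      then show ?thesis
        using invariant.inv_sweep[of i w "cs @ [c]" ds' "cs' @ [c']" "\<delta> (scan_input w i) s c c'"]
          sw sweep
        by (simp add: c' ds run_dfa_append)
    next
      case (swept s')
      then have ds: "ds = []" using * by (auto split: if_splits)
      have i: "i \<noteq> length w + 1" using swept scan_input_Right_End[of i w] sw by simp
      have "word_step (scan_input w i) cs cs'" using sw swept L ds by (simp add: word_step_def)
      then have "reach w (Suc i) cs'" using sw ds reach_Suc by auto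
      then show ?thesis
        using swept sw ds i invariant.inv_return[of "Suc i" w cs' "length cs"]
          tape_of_update(4)[of cs']
        by (simp add: c' h)
    next
      case (finish s')
      then have ds: "ds = []" using * by (auto split: if_splits)
      have i: "i = length w + 1" using finish scan_input_Right_End[of i w] sw by simp
      have "word_step (scan_input w i) cs cs'" using sw finish L ds by (simp add: word_step_def)
      then have "reach w (Suc i) cs'" using sw ds reach_Suc by auto
      then show ?thesis using finish sw ds i L invariant.inv_accept[of h w cs' i]
        by (auto simp: c' h)
    qed (use sw in auto)
  next
    case (inv_accept W)
    from r show ?thesis by cases (use inv_accept in auto)
  qed
qed

lemma steps_inv: "(step1 w)\<^sup>*\<^sup>* (0, 0, \<lambda>_. 0, 0) c \<Longrightarrow> invariant w c"
  by (induction rule: rtranclp_induct) (auto intro: inv_start inv_step)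

text \<open>The head visits the end marker, the word and one blank behind it, which accounts for the
  2. Counters met on the way are no longer than the final one.\<close>

lemma inv_space:
  assumes "invariant w (q, i, t, h)"
  shows "h < length (counter (length w)) + 2"
  using assms
proof cases
  case (inv_inc m ds)
  then have "length (replicate m (1::nat) @ ds) \<le> length (counter (length w))"
    using length_counter_mono[of "i - 1" "length w"] by (metis le_diff_conv)
  then show ?thesis using inv_inc by simp
next
  case inv_back
  then show ?thesis using length_counter_mono[of i "length w"] by simp
next
  case (inv_return W)
  then show ?thesis using reach_letters by fastforce
next
  case (inv_sweep cs ds cs' s)
  then show ?thesis using reach_letters by fastforce
qed auto

lemma space_bounded_machine: "space_bounded machine (\<lambda>n. length (counter n) + 2)"
  unfolding space_bounded_def by (auto simp: reachable_iff dest!: steps_inv inv_space)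

lemma accepts_machineD: "accepts machine w \<Longrightarrow> \<exists>W. chain word_step (symbols w) (counter (length w)) W"
proof -
  assume "accepts machine w"
  then obtain i ts where "reachable machine w (5, i, ts)"
    unfolding accepts_def by (auto simp: machine_def)
  then obtain t h where "invariant w (5, i, t, h)" by (auto simp: reachable_iff dest: steps_inv)
  then show ?thesis by cases (auto simp: length_symbols)
qed

section \<open>Computations realising a given chain of words\<close>

abbreviation steps :: "'a list \<Rightarrow> nat \<times> nat \<times> (nat \<Rightarrow> nat) \<times> nat \<Rightarrow> nat \<times> nat \<times> (nat \<Rightarrow> nat) \<times> nat \<Rightarrow>
  bool" where
  "steps w \<equiv> (step1 w)\<^sup>*\<^sup>*"

lemma step1I:
  "rule (q, scan_input w i, [t h], q', d, [(b, e)]) \<Longrightarrow> i' = min (move_head d i) (length w + 1) \<Longrightarrow>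
   t' = t(h := b) \<Longrightarrow> h' = move_head e h \<Longrightarrow> step1 w (q, i, t, h) (q', i', t', h')"
  unfolding step1_def by auto

text \<open>Each carry moves one cleared digit from \<open>ds\<close> to the end of
  \<open>cs\<close>, so the induction on \<open>ds\<close> needs \<open>cs\<close>
  arbitrary.\<close>

lemma steps_carry:
  assumes "1 \<le> i" "i \<le> length w"
  shows "set ds \<subseteq> {0, 1} \<Longrightarrow>
    \<exists>h \<le> length (cs @ increment ds). steps w (1, i, tape_of (cs @ ds), Suc (length cs)) (2, i,
      tape_of (cs @ increment ds), h)"
proof (induction ds arbitrary: cs)
  case Nil
  have "step1 w (1, i, tape_of cs, Suc (length cs)) (2, i, tape_of (cs @ [1]), length cs)"
    using assms by (intro step1I[where d = Stay and e = Go_Left and b = 3])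
      (auto simp: scan_input_def tape_of_simps tape_of_update_digit(3) intro!: inc[simplified])
  then show ?case by (intro exI[of _ "length cs"]) auto
next
  case (Cons x ds)
  show ?case
  proof (cases "x = 0")
    case True
    have "step1 w (1, i, tape_of (cs @ x # ds), Suc (length cs)) (2, i, tape_of (cs @ 1 # ds),
      length cs)"
      using assms True by (intro step1I[where d = Stay and e = Go_Left and b = 3])
        (auto simp: scan_input_def tape_of_simps tape_of_update_digit(2)[of cs 0 ds] intro!:
          inc[simplified])
    then show ?thesis using True by (intro exI[of _ "length cs"]) auto
  next
    case False
    then have x: "x = 1" using Cons by auto
    have "step1 w (1, i, tape_of (cs @ x # ds), Suc (length cs)) (1, i, tape_of ((cs @ [0]) @ ds),
      Suc (length (cs @ [0])))"
    proof (intro step1I[where d = Stay and e = Go_Right and b = 2])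
      have "tape_of (cs @ x # ds) (Suc (length cs)) = 3"
        unfolding tape_of_simps x by simp
      then show "rule (1, scan_input w i, [tape_of (cs @ x # ds) (Suc (length cs))], 1, Stay, [(2,
        Go_Right)])"
        using assms carry by (simp add: scan_input_def)
    qed (use assms in \<open>simp_all add: tape_of_update_digit\<close>)
    note step = this
    have "set ds \<subseteq> {0, 1}" using Cons.prems by simp
    from Cons.IH[OF this, of "cs @ [0]"] obtain h where h: "h \<le> length ((cs @ [0]) @ increment ds)"
      "steps w (1, i, tape_of ((cs @ [0]) @ ds), Suc (length (cs @ [0]))) (2, i, tape_of ((cs @
        [0]) @ increment ds), h)"
      by blast
    from converse_rtranclp_into_rtranclp[of "step1 w", OF step h(2)] h(1) False show ?thesis
      by (intro exI[of _ h]) simp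
  qed
qed

lemma steps_back:
  assumes "1 \<le> i" "i \<le> length w"
  shows "set W \<subseteq> {0, 1} \<Longrightarrow> h \<le> length W \<Longrightarrow> steps w (2, i, tape_of W, h) (2, i, tape_of W, 0)"
proof (induction h)
  case (Suc h)
  have "step1 w (2, i, tape_of W, Suc h) (2, i, tape_of W, h)"
    using assms Suc.prems tape_of_letter[of "Suc h" W] by (intro step1I[where d = Stay and e =
      Go_Left and b = "tape_of W (Suc h)"])
      (auto simp: scan_input_def intro!: go_back)
  then show ?case using Suc by (simp add: converse_rtranclp_into_rtranclp)
qed auto

lemma steps_count:
  "i \<le> length w \<Longrightarrow> steps w (0, 0, \<lambda>_. 0, 0) (1, Suc i, tape_of (counter i), 1)"
proof (induction i)
  case 0
  have "step1 w (0, 0, \<lambda>_. 0, 0) (1, 1, tape_of (counter 0), 1)"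
    by (intro step1I[where d = Go_Right and e = Go_Right and b = 1])
      (auto simp: scan_input_def counter_def tape_of_def fun_eq_iff intro!: start[simplified])
  then show ?case by auto
next
  case (Suc i)
  then have *: "1 \<le> Suc i" "Suc i \<le> length w" by auto
  from steps_carry[OF * set_counter[of i], of "[]"]
  obtain h where h: "h \<le> length (counter (Suc i))"
    "steps w (1, Suc i, tape_of (counter i), 1) (2, Suc i, tape_of (counter (Suc i)), h)"
    by (auto simp: counter_Suc)
  have "step1 w (2, Suc i, tape_of (counter (Suc i)), 0) (1, Suc (Suc i), tape_of (counter (Suc
    i)), 1)"
    using Suc.prems by (intro step1I[where d = Go_Right and e = Go_Right and b = 1])
      (auto simp: scan_input_def tape_of_simps tape_of_update intro!: advance[simplified])
  from rtranclp.rtrancl_into_rtrancl[OF steps_back[OF * set_counter h(1)] this]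
  have "steps w (2, Suc i, tape_of (counter (Suc i)), h) (1, Suc (Suc i), tape_of (counter (Suc
    i)), 1)" .
  from rtranclp_trans[OF h(2) this] have "steps w (1, Suc i, tape_of (counter i), 1)
    (1, Suc (Suc i), tape_of (counter (Suc i)), 1)" .
  from rtranclp_trans[OF Suc.IH this] * show ?case by simp
qed

lemma steps_rewind:
  "i \<le> length w + 1 \<Longrightarrow> steps w (3, i, tape_of W, 0) (3, 0, tape_of W, 0)"
proof (induction i)
  case (Suc i)
  have "step1 w (3, Suc i, tape_of W, 0) (3, i, tape_of W, 0)"
    using Suc.prems by (intro step1I[where d = Go_Left and e = Stay and b = 1])
      (auto simp: tape_of_simps tape_of_update scan_input_Left_End intro!: rewind[simplified])
  then show ?case using Suc by (simp add: converse_rtranclp_into_rtranclp)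
qed auto

lemma steps_init:
  "steps w (0, 0, \<lambda>_. 0, 0) (6 + s0 Left_End, 0, tape_of (counter (length w)), 1)"
proof -
  let ?t = "tape_of (counter (length w))"
  \<comment> \<open>A blank if the input is empty, otherwise a coded digit.\<close>
  have "?t 1 \<in> {0, 2, 3}"
    using set_counter[of "length w"] tape_of_letter[of 1 "counter (length w)"]
    by (cases "counter (length w)") (auto simp: tape_of_def)
  then have "step1 w (1, Suc (length w), ?t, 1) (3, Suc (length w), ?t, 0)"
    by (intro step1I[where d = Stay and e = Go_Left and b = "?t 1"])
      (auto simp: scan_input_def intro!: counted[simplified])
  moreover have "step1 w (3, 0, ?t, 0) (6 + s0 Left_End, 0, ?t, 1)"
    by (intro step1I[where d = Stay and e = Go_Right and b = 1])
      (auto simp: scan_input_def tape_of_simps tape_of_update intro!: rewound[simplified])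
  moreover have "steps w (3, Suc (length w), ?t, 0) (3, 0, ?t, 0)"
    by (rule steps_rewind) simp
  ultimately have "steps w (1, Suc (length w), ?t, 1) (6 + s0 Left_End, 0, ?t, 1)"
    by (simp add: converse_rtranclp_into_rtranclp rtranclp.rtrancl_into_rtrancl)
  from rtranclp_trans[OF steps_count[of "length w" w, OF order_refl] this] show ?thesis .
qed

text \<open>Even a \<open>Stay\<close> move clamps the input position to
  \<open>length w + 1\<close>; this explains the \<open>min\<close> and the last disjunct, which the
  caller excludes.\<close>

lemma steps_sweep:
  "length ds = length ds' \<Longrightarrow> set ds \<subseteq> {..<A} \<Longrightarrow> set ds' \<subseteq> {..<A} \<Longrightarrow> s \<in> S \<Longrightarrow>
   steps w (6 + s, i, tape_of (cs @ ds), Suc (length cs))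
     (6 + run_dfa (scan_input w i) s ds ds', min i (length w + 1), tape_of (cs @ ds'), Suc (length
       (cs @ ds')))
   \<or> length w + 1 < i"
proof (induction ds ds' arbitrary: s cs rule: list_induct2)
  case (Cons x ds y ds')
  let ?s = "\<delta> (scan_input w i) s x y"
  show ?case
  proof (cases "length w + 1 < i")
    case False
    have "step1 w (6 + s, i, tape_of (cs @ x # ds), Suc (length cs))
        (6 + ?s, i, tape_of ((cs @ [y]) @ ds), Suc (length (cs @ [y])))"
      using Cons.prems False by (intro step1I[where d = Stay and e = Go_Right and b = "y + 2"])
        (auto simp: tape_of_simps tape_of_update(2)[of cs x ds y, symmetric] intro!:
          sweep[simplified])
    then show ?thesis using Cons.IH[of ?s "cs @ [y]"] Cons.prems False
      by (auto simp: \<delta>_in converse_rtranclp_into_rtranclp)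
  qed auto
qed auto

lemma steps_return:
  assumes "i \<le> length w + 1"
  shows "set W \<subseteq> {..<A} \<Longrightarrow> h \<le> length W \<Longrightarrow> steps w (4, i, tape_of W, h) (4, i, tape_of W, 0)"
proof (induction h)
  case (Suc h)
  obtain c where "c < A" "tape_of W (Suc h) = c + 2"
    using tape_of_letter[of "Suc h" W] Suc.prems by auto
  then have "step1 w (4, i, tape_of W, Suc h) (4, i, tape_of W, h)"
    using assms by (intro step1I[where d = Stay and e = Go_Left and b = "tape_of W (Suc h)"])
      (auto intro!: return[simplified])
  then show ?case using Suc by (simp add: converse_rtranclp_into_rtranclp)
qed auto

lemma steps_word_step:
  assumes "i \<le> length w + 1" "word_step (scan_input w i) W W'"
  shows "\<exists>s. s \<in> S \<and> s \<in> Acc (scan_input w i) \<and>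
    steps w (6 + s0 (scan_input w i), i, tape_of W, 1) (6 + s, i, tape_of W', Suc (length W'))"
  using assms steps_sweep[of W W' "s0 (scan_input w i)" w i "[]"] run_dfa_in[of W W'] s0_in
  by (auto simp: word_step_def)

lemma steps_reach:
  "i \<le> length w + 1 \<Longrightarrow> reach w i W \<Longrightarrow>
   steps w (0, 0, \<lambda>_. 0, 0) (6 + s0 (scan_input w i), i, tape_of W, 1)"
proof (induction i arbitrary: W)
  case 0
  then show ?case using steps_init[of w] by (simp add: scan_input_def)
next
  case (Suc i)
  then obtain V where V: "reach w i V" "word_step (scan_input w i) V W"
    by (auto simp: reach_Suc)
  obtain s where s: "s \<in> S" "s \<in> Acc (scan_input w i)"
    "steps w (6 + s0 (scan_input w i), i, tape_of V, 1) (6 + s, i, tape_of W, Suc (length W))"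
    using steps_word_step[OF _ V(2)] Suc.prems by auto
  have "step1 w (6 + s, i, tape_of W, Suc (length W)) (4, Suc i, tape_of W, length W)"
    using Suc.prems s by (intro step1I[where d = Go_Right and e = Go_Left and b = 0])
      (auto simp: tape_of_simps tape_of_update scan_input_Right_End intro!: swept)
  note swept_step = this
  have returned_step:
    "step1 w (4, Suc i, tape_of W, 0) (6 + s0 (scan_input w (Suc i)), Suc i, tape_of W, 1)"
    using Suc.prems by (intro step1I[where d = Stay and e = Go_Right and b = 1])
      (auto simp: tape_of_simps tape_of_update intro!: returned[simplified])
  have "steps w (4, Suc i, tape_of W, length W) (4, Suc i, tape_of W, 0)"
    using Suc.prems V(2) by (intro steps_return) (auto simp: word_step_def)
  from rtranclp.rtrancl_into_rtrancl[OF this returned_step]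
  have "steps w (4, Suc i, tape_of W, length W) (6 + s0 (scan_input w (Suc i)), Suc i, tape_of W,
    1)" .
  from rtranclp_trans[OF s(3) converse_rtranclp_into_rtranclp[of "step1 w", OF swept_step this]]
  have "steps w (6 + s0 (scan_input w i), i, tape_of V, 1)
    (6 + s0 (scan_input w (Suc i)), Suc i, tape_of W, 1)" .
  from rtranclp_trans[OF Suc.IH[OF _ V(1)] this] Suc.prems show ?case by simp
qed

lemma accepts_machine_iff:
  "accepts machine w \<longleftrightarrow> (\<exists>W. chain word_step (symbols w) (counter (length w)) W)"
proof
  assume "\<exists>W. chain word_step (symbols w) (counter (length w)) W"
  then obtain W where "reach w (Suc (length w + 1)) W" by (auto simp: length_symbols)
  then obtain V where V: "reach w (length w + 1) V" "word_step (scan_input w (length w + 1)) V W"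
    unfolding reach_Suc[OF order_refl] by blast
  have R: "scan_input w (length w + 1) = Right_End" by (simp add: scan_input_def)
  obtain s where s: "s \<in> S" "s \<in> Acc Right_End"
    "steps w (6 + s0 Right_End, length w + 1, tape_of V, 1) (6 + s, length w + 1, tape_of W, Suc
      (length W))"
    using steps_word_step[OF _ V(2)] R by auto
  have "step1 w (6 + s, length w + 1, tape_of W, Suc (length W)) (5, length w + 1, tape_of W, Suc
    (length W))"
    using s R by (intro step1I[where d = Stay and e = Stay and b = 0])
      (auto simp: tape_of_simps tape_of_update intro!: finish)
  from rtranclp.rtrancl_into_rtrancl[OF s(3) this]
  have "steps w (0, 0, \<lambda>_. 0, 0) (5, length w + 1, tape_of W, Suc (length W))"
    using steps_reach[OF order_refl V(1)] unfolding R by (rule rtranclp_trans[rotated])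
  then show "accepts machine w"
    unfolding accepts_def reachable_iff by (auto simp: machine_def)
qed (rule accepts_machineD)

theorem language_in_NL: "{w. \<exists>W. chain word_step (symbols w) (counter (length w)) W} \<in> NL"
proof -
  have "{w. \<exists>W. chain word_step (symbols w) (counter (length w)) W} \<in> NSPACE (\<lambda>n. length (counter
    n) + 2)"
    unfolding NSPACE_def using wf_machine space_bounded_machine accepts_machine_iff by blast
  then show ?thesis unfolding NL_def using length_counter_bigo by blast
qed

end

section \<open>Register machines with automatic transitions\<close>

fun regval :: "nat \<Rightarrow> ('v \<Rightarrow> nat) list \<Rightarrow> 'v \<Rightarrow> nat" where
  "regval D [] v = 0"
| "regval D (d # ds) v = d v + D * regval D ds v"

text \<open>
  A register assignment is read as a sequence of digit vectors in base \<open>D\<close>, least significant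
  digits first.
\<close>

definition dfa_for :: "nat \<Rightarrow> (('v \<Rightarrow> nat) \<Rightarrow> bool) \<Rightarrow> nat set \<Rightarrow> (nat \<Rightarrow> ('v \<Rightarrow> nat) \<Rightarrow> nat) \<Rightarrow> nat \<Rightarrow> nat
  set \<Rightarrow> bool" where
  "dfa_for D P S \<delta> s0 Acc \<longleftrightarrow> finite S \<and> s0 \<in> S \<and> (\<forall>s\<in>S. \<forall>d. \<delta> s d \<in> S) \<and>
     (\<forall>ds. (\<forall>d\<in>set ds. \<forall>v. d v < D) \<longrightarrow> (P (regval D ds) \<longleftrightarrow> foldl \<delta> s0 ds \<in> Acc))"

definition recog :: "nat \<Rightarrow> (('v \<Rightarrow> nat) \<Rightarrow> bool) \<Rightarrow> bool" where
  "recog D P \<longleftrightarrow> (\<exists>S \<delta> s0 Acc. dfa_for D P S \<delta> s0 Acc)"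

lemma recogI: "dfa_for D P S \<delta> s0 Acc \<Longrightarrow> recog D P"
  by (auto simp: recog_def)

lemma recog_const: "recog D (\<lambda>_. b)"
  by (rule recogI[of D _ "{0}" "\<lambda>_ _. 0" 0 "if b then UNIV else {}"]) (simp add: dfa_for_def)

lemma recog_not: "recog D P \<Longrightarrow> recog D (\<lambda>x. \<not> P x)"
  unfolding recog_def
proof (elim exE)
  fix S \<delta> s0 Acc assume "dfa_for D P S \<delta> s0 Acc"
  then have "dfa_for D (\<lambda>x. \<not> P x) S \<delta> s0 (- Acc)" by (simp add: dfa_for_def)
  then show "\<exists>S \<delta> s0 Acc. dfa_for D (\<lambda>x. \<not> P x) S \<delta> s0 Acc" by blast
qed

text \<open>Product automaton; \<open>prod_encode\<close> turns a pair of states into the natural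
  number that \<open>dfa_for\<close> expects.\<close>

lemma recog_conj:
  assumes "recog D P" "recog D Q"
  shows "recog D (\<lambda>x. P x \<and> Q x)"
proof -
  obtain S \<delta> s0 Acc where P: "dfa_for D P S \<delta> s0 Acc" using assms(1) by (auto simp: recog_def)
  obtain S' \<delta>' s0' Acc' where Q: "dfa_for D Q S' \<delta>' s0' Acc'" using assms(2) by (auto simp:
    recog_def)
  define \<rho> :: "nat \<Rightarrow> ('a \<Rightarrow> nat) \<Rightarrow> nat"
    where "\<rho> s d = prod_encode (\<delta> (fst (prod_decode s)) d, \<delta>' (snd (prod_decode s)) d)" for s d
  have fold: "foldl \<rho> (prod_encode (a, b)) ds = prod_encode (foldl \<delta> a ds, foldl \<delta>' b ds)" for a b
    ds
    by (induction ds arbitrary: a b) (auto simp: \<rho>_def)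
  have "dfa_for D (\<lambda>x. P x \<and> Q x) (prod_encode ` (S \<times> S')) \<rho> (prod_encode (s0, s0'))
      (prod_encode ` (Acc \<times> Acc'))"
    using P Q unfolding dfa_for_def
    by (simp add: fold inj_image_mem_iff inj_prod_encode) (simp add: \<rho>_def)
  then show ?thesis by (rule recogI)
qed

lemma recog_disj:
  assumes "recog D P" "recog D Q"
  shows "recog D (\<lambda>x. P x \<or> Q x)"
proof -
  note conj = recog_conj[OF recog_not[OF assms(1)] recog_not[OF assms(2)]]
  show ?thesis using recog_not[OF conj] by (simp only: de_Morgan_conj not_not)
qed

lemma recog_imp:
  assumes "recog D P" "recog D Q"
  shows "recog D (\<lambda>x. P x \<longrightarrow> Q x)"
  using recog_disj[OF recog_not[OF assms(1)] assms(2)] by (simp only: imp_conv_disj)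

lemma recog_ball:
  assumes "finite I" "\<And>i. i \<in> I \<Longrightarrow> recog D (P i)"
  shows "recog D (\<lambda>x. \<forall>i\<in>I. P i x)"
  using assms
proof (induction I rule: finite_induct)
  case empty
  show ?case using recog_const[of D True] by simp
next
  case (insert i I)
  have "recog D (\<lambda>x. P i x \<and> (\<forall>i\<in>I. P i x))"
    using insert.IH insert.prems by (intro recog_conj) simp_all
  then show ?case by simp
qed

lemma recog_bex:
  assumes "finite I" "\<And>i. i \<in> I \<Longrightarrow> recog D (P i)"
  shows "recog D (\<lambda>x. \<exists>i\<in>I. P i x)"
proof -
  have "recog D (\<lambda>x. \<forall>i\<in>I. \<not> P i x)"
    using assms(1)
  proof (rule recog_ball)
    fix i assume "i \<in> I"
    then show "recog D (\<lambda>x. \<not> P i x)" by (rule recog_not[OF assms(2)])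
  qed
  from recog_not[OF this] show ?thesis by (simp only: ball_simps not_not)
qed

text \<open>The most significant differing digit decides and is read last, so each differing digit
  simply overrides the verdict so far. For the induction the verdict \<open>s\<close> on the digits
  already read is arbitrary.\<close>

lemma recog_less: "recog D (\<lambda>x. x v < x w)"
proof -
  define \<delta> :: "nat \<Rightarrow> ('a \<Rightarrow> nat) \<Rightarrow> nat"
    where "\<delta> s d = (if d v < d w then 1 else if d v > d w then 0 else s)" for s d
  have "\<lbrakk>\<forall>d\<in>set ds. \<forall>v. d v < D; s \<in> {0, 1}\<rbrakk> \<Longrightarrow>
    foldl \<delta> s ds = 1 \<longleftrightarrow> regval D ds v < regval D ds w \<or> (regval D ds v = regval D ds w \<and> s = 1)"
      for ds s
  proof (induction ds arbitrary: s)
    case (Cons d ds)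
    let ?V = "regval D ds v" and ?W = "regval D ds w"
    have d: "d v < D" "d w < D" using Cons.prems by auto
    have lt: "d v + D * ?V < d w + D * ?W" if "?V < ?W"
    proof -
      have "d v + D * ?V < D * Suc ?V" using d by simp
      also have "\<dots> \<le> D * ?W" using that by (intro mult_le_mono2) simp
      finally show ?thesis by simp
    qed
    have gt: "d w + D * ?W < d v + D * ?V" if "?W < ?V"
    proof -
      have "d w + D * ?W < D * Suc ?W" using d by simp
      also have "\<dots> \<le> D * ?V" using that by (intro mult_le_mono2) simp
      finally show ?thesis by simp
    qed
    have IH: "foldl \<delta> (\<delta> s d) ds = 1 \<longleftrightarrow> ?V < ?W \<or> (?V = ?W \<and> \<delta> s d = 1)"
      using Cons.prems by (intro Cons.IH) (auto simp: \<delta>_def)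
    show ?case
      using IH lt gt by (cases ?V ?W rule: linorder_cases) (auto simp: \<delta>_def[of s d])
  qed auto
  then have "dfa_for D (\<lambda>x. x v < x w) {0, 1} \<delta> 0 {1}"
    by (simp add: dfa_for_def) (simp add: \<delta>_def)
  then show ?thesis by (rule recogI)
qed

lemma digit_split:
  fixes d W X Y D :: nat
  assumes "d < D"
  shows "d + D * W = X + D * Y \<longleftrightarrow> X mod D = d \<and> W = Y + X div D"
proof
  assume *: "d + D * W = X + D * Y"
  have "(d + D * W) mod D = d" "(d + D * W) div D = W" using assms by auto
  moreover have "(X + D * Y) mod D = X mod D" "(X + D * Y) div D = Y + X div D" using assms by auto
  ultimately show "X mod D = d \<and> W = Y + X div D" using * by simp
next
  assume "X mod D = d \<and> W = Y + X div D"
  then show "d + D * W = X + D * Y" using mod_mult_div_eq[of X D] by (auto simp: algebra_simps)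
qed

text \<open>Schoolbook multiplication by a constant: the automaton stores the carry, starts with
  carry \<open>c\<close> and accepts if no carry is left. The case \<open>a = 0\<close> covers
  constants, \<open>a = 1\<close> equality and successor, \<open>a = 2\<close> reading a binary
  digit.\<close>

lemma recog_linear: "recog D (\<lambda>x. x w = a * x v + c)"
proof -
  let ?K = "max a c"
  \<comment> \<open>State 0 is dead and \<open>Suc k\<close> stands for the carry \<open>k\<close>.
    Digits outside the base go to the dead state because \<open>dfa_for\<close> demands closure
    under arbitrary digit vectors.\<close>
  define \<delta> :: "nat \<Rightarrow> ('a \<Rightarrow> nat) \<Rightarrow> nat"
    where "\<delta> s d = (if s = 0 \<or> d v \<ge> D \<or> (a * d v + (s - 1)) mod D \<noteq> d w then 0
      else Suc ((a * d v + (s - 1)) div D))" for s d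
  have dead: "foldl \<delta> 0 ds = 0" for ds by (induction ds) (auto simp: \<delta>_def)
  have correct: "foldl \<delta> (Suc c) ds = 1 \<longleftrightarrow> regval D ds w = a * regval D ds v + c"
    if "\<forall>d\<in>set ds. \<forall>v. d v < D" for ds c
    using that
  proof (induction ds arbitrary: c)
    case (Cons d ds)
    have d: "d v < D" "d w < D" using Cons.prems by auto
    have "regval D (d # ds) w = a * regval D (d # ds) v + c \<longleftrightarrow>
        d w + D * regval D ds w = (a * d v + c) + D * (a * regval D ds v)"
      by (simp add: algebra_simps)
    also have "\<dots> \<longleftrightarrow> (a * d v + c) mod D = d w \<and> regval D ds w = a * regval D ds v + (a * d v + c)
      div D"
      by (rule digit_split[OF d(2)])
    finally show ?case
      using Cons.IH[of "(a * d v + c) div D"] Cons.prems d(1)[unfolded not_le[symmetric]] dead[of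
        ds] by (simp add: \<delta>_def[of "Suc c" d])
  qed auto
  \<comment> \<open>A carry at most \<open>?K\<close> stays so, since
    \<open>(?K * (D - 1) + ?K) div D = ?K\<close>.\<close>
  have closed: "\<delta> s d \<in> {..Suc ?K}" if "s \<in> {..Suc ?K}" for s d
  proof (cases "d v < D")
    case True
    have "a * d v + (s - 1) \<le> ?K * (D - 1) + ?K" using that True by (intro add_mono mult_mono) auto
    also have "\<dots> = ?K * D" using True by (cases D) auto
    finally have "(a * d v + (s - 1)) div D \<le> ?K * D div D" by (rule div_le_mono)
    then show ?thesis using True by (auto simp: \<delta>_def)
  qed (auto simp: \<delta>_def)
  have "dfa_for D (\<lambda>x. x w = a * x v + c) {..Suc ?K} \<delta> (Suc c) {1}"
    unfolding dfa_for_def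
  proof (intro conjI ballI allI impI)
    fix s d assume "s \<in> {..Suc ?K}" then show "\<delta> s d \<in> {..Suc ?K}" by (rule closed)
  next
    fix ds :: "('a \<Rightarrow> nat) list" assume "\<forall>d\<in>set ds. \<forall>v. d v < D"
    then show "regval D ds w = a * regval D ds v + c \<longleftrightarrow> foldl \<delta> (Suc c) ds \<in> {1}" using correct by
      simp
  qed auto
  then show ?thesis by (rule recogI)
qed

lemma recog_eq: "recog D (\<lambda>x. x v = x w)"
  using recog_linear[of D v 1 w 0] by simp

lemma recog_eq_const: "recog D (\<lambda>x. x v = c)"
  using recog_linear[of D v 0 v c] by simp

lemma recog_eq_Suc: "recog D (\<lambda>x. x v = Suc (x w))"
  using recog_linear[of D v 1 w 1] by simp

text \<open>Used to pack one digit of every register into a single tape letter.\<close>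

lemma ex_number_with_digits:
  fixes e :: "nat \<Rightarrow> nat"
  assumes "\<And>i. i < k \<Longrightarrow> e i < D"
  shows "\<exists>c<D ^ k. \<forall>i<k. c div D ^ i mod D = e i"
  using assms
proof (induction k arbitrary: e)
  case (Suc k)
  from Suc.IH[of "\<lambda>i. e (Suc i)"] Suc.prems obtain c where c: "c < D ^ k" "\<forall>i<k. c div D ^ i mod D
    = e (Suc i)"
    by auto
  have e0: "e 0 < D" using Suc.prems by auto
  have "e 0 + D * c < D * Suc c" using e0 by simp
  also have "\<dots> \<le> D ^ Suc k" unfolding power_Suc using c(1) by (intro mult_le_mono2) simp
  finally have "e 0 + D * c < D ^ Suc k" .
  moreover have "(e 0 + D * c) div D ^ i mod D = e i" if "i < Suc k" for i
  proof (cases i)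
    case (Suc j)
    have "(e 0 + D * c) div D ^ i = ((e 0 + D * c) div D) div D ^ j"
      unfolding Suc power_Suc by (rule div_mult2_eq)
    also have "(e 0 + D * c) div D = c" using e0 by simp
    finally show ?thesis using c that Suc by simp
  qed (use e0 in simp)
  ultimately show ?case by (intro exI[of _ "e 0 + D * c"]) simp
qed simp

definition bounded_regs :: "nat \<Rightarrow> 'v set \<Rightarrow> nat \<Rightarrow> ('v \<Rightarrow> nat) \<Rightarrow> bool" where
  "bounded_regs D Vs L x \<longleftrightarrow> (\<forall>v. x v < D ^ L \<and> (v \<notin> Vs \<longrightarrow> x v = 0))"

text \<open>The tape starts with the counter, whose letters decode to some meaningless assignment.
  By \<open>left\<close> the first step ignores it, so it is as good as the arbitrary
  \<open>x\<close> in the language.\<close>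

theorem register_language_in_NL:
  fixes Rel :: "'a::finite input_symbol \<Rightarrow> ('v \<Rightarrow> nat) \<Rightarrow> ('v \<Rightarrow> nat) \<Rightarrow> bool"
  assumes D: "2 \<le> D" and Vs: "finite Vs"
    and rec: "\<And>a. recog D (\<lambda>z. Rel a (\<lambda>v. z (False, v)) (\<lambda>v. z (True, v)))"
    and left: "\<And>x x' y. Rel Left_End x y \<Longrightarrow> Rel Left_End x' y"
  shows "{w. \<exists>x y. chain (\<lambda>a x y. bounded_regs D Vs (length (counter (length w))) y \<and> Rel a x y)
    (symbols w) x y} \<in> NL"
proof -
  obtain S \<delta> s0 Acc where dfa:
    "dfa_for D (\<lambda>z. Rel a (\<lambda>v. z (False, v)) (\<lambda>v. z (True, v))) (S a) (\<delta> a) (s0 a) (Acc a)" for a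
  proof -
    let ?P = "\<lambda>a z. Rel a (\<lambda>v. z (False, v)) (\<lambda>v. z (True, v))"
    have "\<exists>p. dfa_for D (?P a) (fst p) (fst (snd p)) (fst (snd (snd p))) (snd (snd (snd p)))" for a
      using rec[of a] unfolding recog_def by auto
    then have "\<forall>a. \<exists>p. dfa_for D (?P a) (fst p) (fst (snd p)) (fst (snd (snd p))) (snd (snd (snd
      p)))"
      by blast
    from choice[OF this] obtain f where "\<forall>a. dfa_for D (?P a) (fst (f a)) (fst (snd (f a)))
        (fst (snd (snd (f a)))) (snd (snd (snd (f a))))"
      by blast
    then show ?thesis
      by (intro that[of "\<lambda>a. fst (f a)" "\<lambda>a. fst (snd (f a))" "\<lambda>a. fst (snd (snd (f a)))"
            "\<lambda>a. snd (snd (snd (f a)))"]) blast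
  qed
  obtain h where h: "bij_betw h Vs {0..<card Vs}" using ex_bij_betw_finite_nat[OF Vs] by blast
  define k where "k = card Vs"
  \<comment> \<open>\<open>D ^ k\<close> letters would hold the digits; the extra factor ensures
    \<open>2 \<le> A\<close> even without registers, as the counter needs the letters 0 and
    1.\<close>
  define A where "A = D ^ Suc k"
  define dig where "dig c v = (if v \<in> Vs then c div D ^ h v mod D else 0)" for c v
  define pair where "pair c c' = (\<lambda>(b, v). if b then dig c' v else dig c v)" for c c' :: nat
  \<comment> \<open>The locale wants one state set closed under all automata. A state foreign to
    \<open>S a\<close> is therefore sent to \<open>s0 a\<close>; this never happens in a sweep
    started at \<open>s0 a\<close>.\<close>
  define \<delta>' where "\<delta>' a s c c' = (if s \<in> S a then \<delta> a s (pair c c') else s0 a)" for a s c c'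
  define S' where "S' = (\<Union>a. S a)"
  have dig_less: "dig c v < D" for c v using D by (simp add: dig_def)
  have pair_less: "pair c c' bv < D" for c c' bv using dig_less by (simp add: pair_def split:
    prod.split)
  interpret sweeping A S' \<delta>' s0 Acc
  proof
    have "D ^ 1 \<le> A" unfolding A_def using D by (intro power_increasing) auto
    then show "2 \<le> A" using D by simp
    show "finite S'" unfolding S'_def using dfa finite_input_symbol by (auto simp: dfa_for_def)
    show "s0 a \<in> S'" for a using dfa by (auto simp: dfa_for_def S'_def)
    show "\<delta>' a s c c' \<in> S'" for a s c c' using dfa by (auto simp: dfa_for_def S'_def \<delta>'_def)
  qed
  define asg where "asg W = regval D (map dig W)" for W
  have run: "run_dfa a s W W' = foldl (\<delta> a) s (map2 pair W W')" if "length W = length W'" "s \<in> S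
    a" for a s W W'
    using that
  proof (induction W W' arbitrary: s rule: list_induct2)
    case (Cons c cs c' cs')
    then have "\<delta> a s (pair c c') \<in> S a" using dfa by (simp add: dfa_for_def)
    moreover have "\<delta>' a s c c' = \<delta> a s (pair c c')" using Cons.prems by (simp add: \<delta>'_def)
    ultimately show ?case using Cons.IH by simp
  qed simp
  have regval_pair: "regval D (map2 pair W W') (b, v) = (if b then asg W' v else asg W v)"
    if "length W = length W'" for W W' b v
    using that by (induction W W' rule: list_induct2) (auto simp: asg_def pair_def)
  have word_step: "word_step a W W' \<longleftrightarrow> length W = length W' \<and> set W \<subseteq> {..<A} \<and> set W' \<subseteq> {..<A} \<and>
      Rel a (asg W) (asg W')" for a W W'
  proof (cases "length W = length W'")
    case True
    have "Rel a (\<lambda>v. regval D (map2 pair W W') (False, v)) (\<lambda>v. regval D (map2 pair W W') (True, v))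
        \<longleftrightarrow> foldl (\<delta> a) (s0 a) (map2 pair W W') \<in> Acc a"
      using dfa[of a] pair_less unfolding dfa_for_def by (auto simp: set_zip)
    moreover have "s0 a \<in> S a" using dfa by (simp add: dfa_for_def)
    ultimately show ?thesis using True by (simp add: word_step_def run regval_pair)
  qed (simp add: word_step_def)
  have asg_bounded: "bounded_regs D Vs (length W) (asg W)" for W
  proof -
    have "asg W v < D ^ length W" for v
    proof (induction W)
      case (Cons c W)
      have "dig c v + D * asg W v < D * Suc (asg W v)" using dig_less by simp
      also have "\<dots> \<le> D * D ^ length W" using Cons by (intro mult_le_mono2) simp
      finally show ?case by (simp add: asg_def)
    qed (simp add: asg_def)
    moreover have "asg W v = 0" if "v \<notin> Vs" for v
      using that by (induction W) (auto simp: asg_def dig_def)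
    ultimately show ?thesis by (simp add: bounded_regs_def)
  qed
  have dig_surj: "\<exists>c<A. dig c = d" if d: "\<And>v. d v < D" "\<And>v. v \<notin> Vs \<Longrightarrow> d v = 0" for d
  proof -
    have "\<exists>c<D ^ k. \<forall>i<k. c div D ^ i mod D = d (inv_into Vs h i)"
      using d by (intro ex_number_with_digits) auto
    then obtain c where c: "c < D ^ k" "\<forall>i<k. c div D ^ i mod D = d (inv_into Vs h i)" by blast
    have "D ^ k \<le> A" unfolding A_def using D by (intro power_increasing) auto
    moreover have "dig c v = d v" for v
    proof (cases "v \<in> Vs")
      case True
      then have "h v < k" using h by (auto simp: bij_betw_def k_def)
      moreover have "inv_into Vs h (h v) = v" using h True by (simp add: bij_betw_def)
      ultimately show ?thesis using c True by (simp add: dig_def)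
    qed (simp add: dig_def d)
    ultimately show ?thesis using c by (intro exI[of _ c]) auto
  qed
  \<comment> \<open>Words have exactly \<open>L\<close> letters: small values are padded by zero
    digits, which do not affect \<open>regval\<close>.\<close>
  have asg_surj: "\<exists>W. length W = L \<and> set W \<subseteq> {..<A} \<and> asg W = x" if "bounded_regs D Vs L x" for L x
    using that
  proof (induction L arbitrary: x)
    case 0
    then show ?case by (auto simp: bounded_regs_def asg_def fun_eq_iff)
  next
    case (Suc L)
    have "bounded_regs D Vs L (\<lambda>v. x v div D)"
      using Suc.prems D by (auto simp: bounded_regs_def less_mult_imp_div_less mult.commute)
    then obtain W where W: "length W = L" "set W \<subseteq> {..<A}" "asg W = (\<lambda>v. x v div D)" using Suc.IH
      by blast
    obtain c where c: "c < A" "dig c = (\<lambda>v. x v mod D)"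
      using dig_surj[of "\<lambda>v. x v mod D"] Suc.prems D by (auto simp: bounded_regs_def)
    have "asg (c # W) v = x v" for v
      using fun_cong[OF W(3), of v] fun_cong[OF c(2), of v] by (simp add: asg_def)
    then show ?case using W c by (intro exI[of _ "c # W"]) auto
  qed
  let ?R = "\<lambda>L a x y. bounded_regs D Vs L y \<and> Rel a x y"
  have to_regs: "chain (?R (length W)) as (asg W) (asg W')" if "chain word_step as W W'" for as W W'
    using that
  proof (induction as arbitrary: W)
    case (Cons a as)
    then obtain V where V: "word_step a W V" "chain word_step as V W'" by auto
    then have "length V = length W" by (simp add: word_step)
    then show ?case using V Cons.IH[OF V(2)] asg_bounded[of V] by (auto simp: word_step)
  qed simp
  have from_regs: "\<exists>W'. chain word_step as W W'"
    if "chain (?R (length W)) as (asg W) y" "set W \<subseteq> {..<A}" for as W y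
    using that
  proof (induction as arbitrary: W)
    case (Cons a as)
    then obtain z where z: "bounded_regs D Vs (length W) z" "Rel a (asg W) z" "chain (?R (length
      W)) as z y" by auto
    obtain V where V: "length V = length W" "set V \<subseteq> {..<A}" "asg V = z" using asg_surj[OF z(1)]
      by blast
    then obtain W' where "chain word_step as V W'" using Cons.IH[of V] z by auto
    moreover have "word_step a W V" using V z Cons.prems by (simp add: word_step)
    ultimately show ?case by auto
  next
    case Nil
    show ?case by (rule exI[of _ W]) simp
  qed
  have "(\<exists>x y. chain (?R (length (counter (length w)))) (symbols w) x y) \<longleftrightarrow>
      (\<exists>W. chain word_step (symbols w) (counter (length w)) W)" for w :: "'a list"
  proof
    assume "\<exists>x y. chain (?R (length (counter (length w)))) (symbols w) x y"
    then have "\<exists>y. chain (?R (length (counter (length w)))) (symbols w) (asg (counter (length w)))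
      y"
      using left by (auto simp: symbols_def) blast
    then show "\<exists>W. chain word_step (symbols w) (counter (length w)) W"
      using from_regs counter_letters by blast
  qed (use to_regs in blast)
  then show ?thesis using language_in_NL by simp
qed

section \<open>Certificates for asynchronous runs\<close>

text \<open>Slots are numbered from 0 so that they can index registers; slot \<open>r\<close> is the
  centre.\<close>

definition cell :: "nat \<Rightarrow> nat \<Rightarrow> nat \<Rightarrow> nat \<Rightarrow> nat" where
  "cell n r v d = nat ((int v + (int d - int r)) mod int n)"

lemma cell_less: "0 < n \<Longrightarrow> cell n r v d < n"
  by (simp add: cell_def nat_less_iff)

lemma cell_center: "v < n \<Longrightarrow> cell n r v r = v"
  by (simp add: cell_def)

lemma neighborhood_cell:
  "neighborhood F x v = map (\<lambda>d. x ! cell (length x) (radius F) v d) [0..<2 * radius F + 1]"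
  unfolding neighborhood_def cell_def
  by (rule nth_equalityI) (auto simp: nth_upto algebra_simps simp del: upt_Suc)

text \<open>
  A history of a cell consists of functions \<open>B\<close> and \<open>P\<close>: for a state \<open>q\<close> entered during the run,
  \<open>B q \<ge> 1\<close> is the number of the block and \<open>P q\<close> the position inside this block at which \<open>q\<close> is
    entered.
  The initial state has the time \<open>(0, 1)\<close> and every state that is never entered the time \<open>(0, 0)\<close>.
  As the former is later, the state at any moment is the one with the latest time so far, without
  a special treatment of the states that do not occur.
\<close>

definition start_state_at :: "('q \<Rightarrow> nat) \<Rightarrow> ('q \<Rightarrow> nat) \<Rightarrow> nat \<Rightarrow> 'q \<Rightarrow> bool" where
  "start_state_at B P b s \<longleftrightarrow> B s < b \<and>
     (\<forall>s'. s' \<noteq> s \<longrightarrow> B s' < b \<longrightarrow> B s' < B s \<or> B s' = B s \<and> P s' < P s)"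

definition state_at :: "('q \<Rightarrow> nat) \<Rightarrow> ('q \<Rightarrow> nat) \<Rightarrow> nat \<Rightarrow> nat \<Rightarrow> 'q \<Rightarrow> bool" where
  "state_at B P b \<rho> s \<longleftrightarrow> (B s = b \<and> P s < \<rho>) \<or>
     ((\<forall>s'. \<not> (B s' = b \<and> P s' < \<rho>)) \<and> start_state_at B P b s)"

text \<open>\<open>g\<close> is the neighbourhood that the central cell sees when updated at
  position \<open>\<rho>\<close> of block \<open>b\<close>. If the update has no effect,
  \<open>\<rho>\<close> is recorded nowhere and need not be known to other windows.\<close>

definition update_ok :: "('q list \<Rightarrow> 'q) \<Rightarrow> nat \<Rightarrow> (nat \<Rightarrow> 'q \<Rightarrow> nat) \<Rightarrow> (nat \<Rightarrow> 'q \<Rightarrow> nat) \<Rightarrow> nat \<Rightarrow> nat \<Rightarrow>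
  'q list \<Rightarrow> bool" where
  "update_ok f r B P b \<rho> g \<longleftrightarrow> length g = 2 * r + 1 \<and> (\<forall>d<2 * r + 1. state_at (B d) (P d) b \<rho> (g !
    d)) \<and>
     ((\<exists>q. B r q = b \<and> P r q = \<rho> \<and> f g = q) \<or> (\<forall>q. B r q \<noteq> b) \<and> f g = g ! r)"

text \<open>Two changes of one cell never share a block, as a block updates it once.
  \<open>I\<close> gives the identity of the cells: when the cycle is short the centre may fill
  several slots, and its change coincides with itself.\<close>

definition window_ok :: "('q list \<Rightarrow> 'q) \<Rightarrow> nat \<Rightarrow> 'q \<Rightarrow> (nat \<Rightarrow> 'q \<Rightarrow> nat) \<Rightarrow> (nat \<Rightarrow> 'q \<Rightarrow> nat) \<Rightarrow> (nat \<Rightarrow>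
  nat) \<Rightarrow> bool" where
  "window_ok f r q0 B P I \<longleftrightarrow>
     B r q0 = 0 \<and> P r q0 = 1 \<and> (\<forall>q. q \<noteq> q0 \<longrightarrow> B r q = 0 \<longrightarrow> P r q = 0) \<and>
     (\<forall>q q'. q \<noteq> q' \<longrightarrow> B r q = B r q' \<longrightarrow> B r q = 0) \<and>
     (\<forall>d<2 * r + 1. \<forall>q q'. B r q = B d q' \<longrightarrow> B r q \<noteq> 0 \<longrightarrow> P r q = P d q' \<longrightarrow> I r = I d) \<and>
     (\<forall>b\<ge>1. \<exists>\<rho> g. update_ok f r B P b \<rho> g)"

definition certificate :: "'q ca \<Rightarrow> 'q list \<Rightarrow> (nat \<Rightarrow> 'q \<Rightarrow> nat) \<Rightarrow> (nat \<Rightarrow> 'q \<Rightarrow> nat) \<Rightarrow> bool" where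
  "certificate F x \<beta> \<pi> \<longleftrightarrow> (\<forall>v<length x. let c = cell (length x) (radius F) v in
     window_ok (local_fun F) (radius F) (x ! v) (\<lambda>d. \<beta> (c d)) (\<lambda>d. \<pi> (c d)) c)"

section \<open>From a certificate to an update scheme\<close>

lemma start_state_at_unique:
  assumes "start_state_at B P b s" "start_state_at B P b s'"
  shows "s = s'"
proof (rule ccontr)
  assume "s \<noteq> s'"
  then have "B s < B s' \<or> B s = B s' \<and> P s < P s'" "B s' < B s \<or> B s' = B s \<and> P s' < P s"
    using assms by (auto simp: start_state_at_def)
  then show False by linarith
qed

text \<open>Identifies the neighbourhood guessed in \<open>update_ok\<close> with the actual one,
  since both satisfy \<open>state_at\<close>.\<close>

lemma state_at_unique:
  assumes "\<forall>q q'. q \<noteq> q' \<longrightarrow> B q = B q' \<longrightarrow> B q = 0" "b \<ge> 1" "state_at B P b \<rho> s" "state_at B P b \<rho> s'"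
  shows "s = s'"
proof (rule ccontr)
  assume "s \<noteq> s'"
  then have "\<not> (B s = b \<and> B s' = b)" using assms(1)[rule_format, of s s'] assms(2) by auto
  moreover have "\<not> (start_state_at B P b s \<and> start_state_at B P b s')"
    using start_state_at_unique[of B P b s s'] \<open>s \<noteq> s'\<close> by blast
  ultimately show False using assms(3,4) unfolding state_at_def by blast
qed

lemma length_async_run [simp]: "length (async_run F \<sigma> x t) = length x"
  by (induction t) auto

lemma sorted_key_take:
  assumes "sorted (map k xs)" "i < length xs" "distinct xs" "w \<in> set xs"
  shows "k w < k (xs ! i) \<Longrightarrow> w \<in> set (take i xs)" "k (xs ! i) < k w \<Longrightarrow> w \<notin> set (take i xs)"
proof -
  obtain j where j: "j < length xs" "w = xs ! j" using assms(4) unfolding in_set_conv_nth by blast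
  have mono: "k (xs ! a) \<le> k (xs ! b)" if "a \<le> b" "b < length xs" for a b
    using sorted_nth_mono[OF assms(1), of a b] that by simp
  show "w \<in> set (take i xs)" if "k w < k (xs ! i)"
  proof -
    have "j < i" using mono[of i j] that j by (cases "j < i") simp_all
    then have "take i xs ! j = w" "j < length (take i xs)" using j assms(2) by simp_all
    then show ?thesis using nth_mem by metis
  qed
  show "w \<notin> set (take i xs)" if "k (xs ! i) < k w"
  proof
    assume "w \<in> set (take i xs)"
    then obtain a where "a < i" "w = xs ! a" by (auto simp: in_set_conv_nth)
    then show False using mono[of a i] that assms(2) by simp
  qed
qed

text \<open>In each block the cells are sorted by their locally chosen moments. Induction along the
  block shows that every update sees exactly the neighbourhood its window guessed.\<close>

theorem certificate_sound:
  fixes F :: "'q ca"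
  assumes cert: "certificate F x \<beta> \<pi>" and u: "u < length x" and q: "q \<noteq> x ! u" "\<beta> u q \<noteq> 0"
  shows "\<exists>\<sigma> T. sequential_scheme (length x) \<sigma> \<and> T > 0 \<and> async_run F \<sigma> x T ! u \<noteq> x ! u"
proof -
  define n where "n = length x"
  define r where "r = radius F"
  define f where "f = local_fun F"
  have n: "0 < n" using u unfolding n_def by linarith
  let ?c = "cell n r"
  have win: "window_ok f r (x ! v) (\<lambda>d. \<beta> (?c v d)) (\<lambda>d. \<pi> (?c v d)) (?c v)" if "v < n" for v
    using cert that by (simp add: certificate_def n_def r_def f_def Let_def)
  have init: "\<beta> v (x ! v) = 0" "\<pi> v (x ! v) = 1" "q \<noteq> x ! v \<Longrightarrow> \<beta> v q = 0 \<Longrightarrow> \<pi> v q = 0" if "v < n"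
    for v q
    using win[OF that] that by (auto simp: window_ok_def cell_center)
  have distinct_blocks: "\<forall>q q'. q \<noteq> q' \<longrightarrow> \<beta> v q = \<beta> v q' \<longrightarrow> \<beta> v q = 0" if "v < n" for v
    using win[OF that] that by (simp add: window_ok_def cell_center)
  have uniq: "q = q'" if "v < n" "\<beta> v q = b" "\<beta> v q' = b" "b \<ge> 1" for v q q' b
  proof (rule ccontr)
    assume "q \<noteq> q'"
    then have "\<beta> v q = 0" using distinct_blocks[OF that(1), rule_format, of q q'] that(2,3) by simp
    then show False using that by simp
  qed
  have no_tie: "v = w" if "v < n" "w = ?c v d" "d < 2 * r + 1" "\<beta> v q = \<beta> w q'" "\<beta> v q \<noteq> 0" "\<pi> v q
    = \<pi> w q'" for v w d q q'
  proof -
    have "\<forall>d<2 * r + 1. \<forall>q q'. \<beta> v q = \<beta> (?c v d) q' \<longrightarrow> \<beta> v q \<noteq> 0 \<longrightarrow> \<pi> v q = \<pi> (?c v d) q' \<longrightarrow> v = ?c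
      v d"
      using win[OF that(1)] that(1) by (simp add: window_ok_def cell_center)
    then show ?thesis using that by blast
  qed
  let ?ok = "\<lambda>b v \<rho> g. update_ok f r (\<lambda>d. \<beta> (?c v d)) (\<lambda>d. \<pi> (?c v d)) b \<rho> g"
  define R where "R b v = (SOME \<rho>. \<exists>g. ?ok b v \<rho> g)" for b v
  define G where "G b v = (SOME g. ?ok b v (R b v) g)" for b v
  have ok: "?ok b v (R b v) (G b v)" if "b \<ge> 1" "v < n" for b v
  proof -
    have "\<exists>\<rho> g. ?ok b v \<rho> g" using win[OF that(2)] that(1) by (simp add: window_ok_def)
    then have "\<exists>g. ?ok b v (R b v) g" unfolding R_def by (rule someI_ex)
    then show ?thesis unfolding G_def by (rule someI_ex)
  qed
  define ev where "ev b v = (\<exists>q. \<beta> v q = b)" for b v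
  \<comment> \<open>A cell with the even key \<open>2 * \<rho>\<close> is updated after the changes at positions below \<open>\<rho>\<close> and before
    the others.\<close>
  define key where "key b v = (if ev b v then 2 * R b v + 1 else 2 * R b v)" for b v
  define ord where "ord b = sort_key (key b) [0..<n]" for b
  have ord: "sorted (map (key b) (ord b))" "distinct (ord b)" "set (ord b) = {..<n}"
    "length (ord b) = n" for b
    by (auto simp: ord_def)
  define \<sigma> where "\<sigma> t = ord (Suc ((t - 1) div n)) ! ((t - 1) mod n)" for t
  have \<sigma>: "\<sigma> (Suc ((b - 1) * n + i)) = ord b ! i" if "b \<ge> 1" "i < n" for b i
    using that by (simp add: \<sigma>_def)
  have scheme: "sequential_scheme n \<sigma>"
    unfolding sequential_scheme_def
  proof (intro conjI allI impI)
    fix t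
    have "\<sigma> t \<in> set (ord (Suc ((t - 1) div n)))" unfolding \<sigma>_def using n ord(4) by (intro nth_mem)
      simp
    then show "\<sigma> t < n" using ord(3) by auto
  next
    fix k :: nat assume k: "k \<ge> 1"
    have "bij_betw (\<lambda>i. ord k ! i) {..<n} {..<n}"
      using ord[of k] by (intro bij_betw_nth) auto
    moreover have "bij_betw (\<lambda>t. t - ((k - 1) * n + 1)) {(k - 1) * n + 1..k * n} {..<n}"
    proof (rule bij_betw_byWitness[where f' = "\<lambda>i. (k - 1) * n + 1 + i"])
      have "k * n = (k - 1) * n + n" using k by (cases k) auto
      then show "(\<lambda>t. t - ((k - 1) * n + 1)) ` {(k - 1) * n + 1..k * n} \<subseteq> {..<n}"
        "(\<lambda>i. (k - 1) * n + 1 + i) ` {..<n} \<subseteq> {(k - 1) * n + 1..k * n}" by auto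
    qed auto
    ultimately have "bij_betw ((\<lambda>i. ord k ! i) \<circ> (\<lambda>t. t - ((k - 1) * n + 1))) {(k - 1) * n + 1..k
      * n} {..<n}"
      by (rule bij_betw_trans[rotated])
    moreover have "((\<lambda>i. ord k ! i) \<circ> (\<lambda>t. t - ((k - 1) * n + 1))) t = \<sigma> t" if t: "t \<in> {(k - 1) *
      n + 1..k * n}" for t
    proof -
      have "k * n = (k - 1) * n + n" using k by (cases k) auto
      then obtain i where "t = Suc ((k - 1) * n + i)" "i < n"
        using t by (intro that[of "t - ((k - 1) * n + 1)"]) auto
      then show ?thesis using \<sigma>[OF k] by simp
    qed
    ultimately show "bij_betw \<sigma> {(k - 1) * n + 1..k * n} {..<n}" using bij_betw_cong by blast
  qed
  \<comment> \<open>The intended state of \<open>v\<close> at the beginning of block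
    \<open>b\<close>. Block 0 is only the dummy block of the initial state, hence the guard.\<close>
  define st where "st v = rec_nat (x ! v) (\<lambda>b s. if b \<ge> 1 \<and> ev b v then THE q. \<beta> v q = b else s)"
    for v
  have st_Suc: "st v (Suc b) = (if b \<ge> 1 \<and> ev b v then THE q. \<beta> v q = b else st v b)" for v b
    by (simp add: st_def)
  have st_event: "st v (Suc b) = q" if "v < n" "b \<ge> 1" "\<beta> v q = b" for v b q
  proof -
    have "(THE q. \<beta> v q = b) = q"
      using that(3) uniq[OF that(1) _ that(3,2)] by (rule the_equality)
    then show ?thesis using that by (auto simp: st_Suc ev_def)
  qed
  have st_same: "st v (Suc b) = st v b" if "\<not> ev b v" for v b using that by (simp add: st_Suc)
  have st_start: "start_state_at (\<beta> v) (\<pi> v) (Suc b) (st v (Suc b))" if v: "v < n" for v b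
  proof (induction b)
    case 0
    have "st v (Suc 0) = x ! v" by (simp add: st_def)
    then show ?case using init[OF v] by (auto simp: start_state_at_def)
  next
    case (Suc b)
    show ?case
    proof (cases "ev (Suc b) v")
      case True
      then obtain q where q: "\<beta> v q = Suc b" by (auto simp: ev_def)
      then have "st v (Suc (Suc b)) = q" using st_event v by simp
      moreover have "\<beta> v s \<noteq> Suc b" if "s \<noteq> q" for s
        using uniq[OF v _ q, of s] that by auto
      ultimately show ?thesis using q by (auto simp: start_state_at_def less_Suc_eq)
    next
      case False
      then have "\<beta> v s \<noteq> Suc b" for s by (auto simp: ev_def)
      then show ?thesis using Suc st_same[OF False] by (simp add: start_state_at_def less_Suc_eq)
    qed
  qed
  \<comment> \<open>Within a block a cell has its old state before its only update and its final
    state afterwards.\<close>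
  have run: "\<forall>w<n. async_run F \<sigma> x ((b - 1) * n + i) ! w = (if w \<in> set (take i (ord b)) then st w
    (Suc b) else st w b)"
    if b: "b \<ge> 1" and i: "i \<le> n" and base: "\<forall>w<n. async_run F \<sigma> x ((b - 1) * n) ! w = st w b" for
      b i
    using i
  proof (induction i)
    case 0
    then show ?case using base by simp
  next
    case (Suc i)
    let ?X = "async_run F \<sigma> x ((b - 1) * n + i)"
    define v where "v = ord b ! i"
    have i: "i < n" using Suc.prems by simp
    have v: "v < n" using nth_mem[of i "ord b"] i ord by (auto simp: v_def)
    have IH: "?X ! w = (if w \<in> set (take i (ord b)) then st w (Suc b) else st w b)" if "w < n" for w
      using Suc that by simp
    have v_notin: "v \<notin> set (take i (ord b))"
      using ord(2,4)[of b] i by (auto simp: v_def in_set_conv_nth nth_eq_iff_index_eq)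
    define \<rho> where "\<rho> = R b v"
    define g where "g = G b v"
    have ok': "length g = 2 * r + 1" "\<And>d. d < 2 * r + 1 \<Longrightarrow> state_at (\<beta> (?c v d)) (\<pi> (?c v d)) b \<rho>
      (g ! d)"
      "(\<exists>q. \<beta> v q = b \<and> \<pi> v q = \<rho> \<and> f g = q) \<or> \<not> ev b v \<and> f g = g ! r"
      using ok[OF b v] v by (auto simp: update_ok_def cell_center \<rho>_def g_def ev_def)
    have event_R: "\<pi> w q = R b w" if wn: "w < n" and wq: "\<beta> w q = b" for w q
    proof -
      obtain q' where "\<beta> w q' = b" "\<pi> w q' = R b w"
        using ok[OF b wn] wn wq by (auto simp: update_ok_def cell_center)
      moreover have "q' = q" using uniq[OF wn calculation(1) wq b] .
      ultimately show ?thesis by simp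
    qed
    have key_event: "key b w = 2 * \<pi> w q + 1" if "w < n" "\<beta> w q = b" for w q
      using event_R[OF that] that by (auto simp: key_def ev_def)
    \<comment> \<open>Recorded order and scheduled order agree inside a window: two changes are
      separated by \<open>no_tie\<close>, a change and an idle update by the parity of the
      keys.\<close>
    have before: "\<pi> w q < \<rho> \<longleftrightarrow> w \<in> set (take i (ord b))"
      if w: "w = ?c v d" "d < 2 * r + 1" and q: "\<beta> w q = b" for w d q
    proof (cases "w = v")
      case True
      then have "\<pi> v q = \<rho>" using event_R[OF v] q by (simp add: \<rho>_def)
      then show ?thesis using True v_notin by simp
    next
      case False
      have wn: "w < n" using w cell_less n by simp
      have kw: "key b w = 2 * \<pi> w q + 1" using key_event wn q by simp
      have "key b w \<noteq> key b v \<and> (\<pi> w q < \<rho> \<longleftrightarrow> key b w < key b v)"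
      proof (cases "ev b v")
        case True
        then obtain q' where q': "\<beta> v q' = b" by (auto simp: ev_def)
        then have "\<pi> v q' = \<rho>" using event_R[OF v q'] by (simp add: \<rho>_def)
        moreover have "\<pi> v q' \<noteq> \<pi> w q" using no_tie[OF v w, of q' q] False q q' b by auto
        ultimately show ?thesis using True unfolding kw by (auto simp: key_def \<rho>_def)
      next
        case False
        then have kv: "key b v = 2 * \<rho>" by (simp add: key_def \<rho>_def)
        have "2 * a + 1 \<noteq> 2 * c \<and> (a < c \<longleftrightarrow> 2 * a + 1 < 2 * c)" for a c :: nat by presburger
        then show ?thesis unfolding kw kv .
      qed
      moreover have il: "i < length (ord b)" "w \<in> set (ord b)" using i wn ord(3,4) by simp_all
      moreover note sorted_key_take[OF ord(1) il(1) ord(2) il(2), folded v_def]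
      ultimately show ?thesis by (metis linorder_neqE_nat)
    qed
    have X_state: "state_at (\<beta> w) (\<pi> w) b \<rho> (?X ! w)" if w: "w = ?c v d" "d < 2 * r + 1" for w d
    proof -
      have wn: "w < n" using w cell_less n by simp
      have start: "start_state_at (\<beta> w) (\<pi> w) b (st w b)" using st_start[OF wn, of "b - 1"] b by
        simp
      show ?thesis
      proof (cases "ev b w")
        case True
        then obtain q where q: "\<beta> w q = b" by (auto simp: ev_def)
        have st: "st w (Suc b) = q" using st_event wn b q by simp
        have only: "s = q" if "\<beta> w s = b" for s using uniq[OF wn that q b] .
        show ?thesis
        proof (cases "w \<in> set (take i (ord b))")
          case True
          then have Xw: "?X ! w = q" using IH[OF wn] st by simp
          show ?thesis unfolding Xw using True before[OF w q] q by (simp add: state_at_def)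
        next
          case False
          then have "\<forall>s'. \<not> (\<beta> w s' = b \<and> \<pi> w s' < \<rho>)" using before[OF w q] only by metis
          moreover have Xw: "?X ! w = st w b" using IH[OF wn] False by simp
          ultimately show ?thesis unfolding Xw using start by (simp add: state_at_def)
        qed
      next
        case False
        then have Xw: "?X ! w = st w b" using IH[OF wn] st_same by simp
        show ?thesis unfolding Xw using False start by (simp add: state_at_def ev_def)
      qed
    qed
    have "neighborhood F ?X v = map (\<lambda>d. ?X ! ?c v d) [0..<2 * r + 1]"
      by (simp add: neighborhood_cell n_def r_def)
    also have "\<dots> = g"
    proof (rule nth_equalityI)
      fix d assume "d < length (map (\<lambda>d. ?X ! ?c v d) [0..<2 * r + 1])"
      then have d: "d < 2 * r + 1" by simp
      have "?X ! ?c v d = g ! d"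
        using state_at_unique[OF distinct_blocks[OF cell_less[OF n]] b X_state[OF refl d]
          ok'(2)[OF d]] .
      then show "map (\<lambda>d. ?X ! ?c v d) [0..<2 * r + 1] ! d = g ! d" using d by (simp del: upt_Suc)
    qed (use ok' in simp)
    finally have nb: "neighborhood F ?X v = g" .
    have "g ! r = ?X ! v"
      using state_at_unique[OF distinct_blocks[OF cell_less[OF n]] b X_state[OF refl, of r]
        ok'(2)[of r]] v
      by (simp add: cell_center)
    then have new: "f g = st v (Suc b)"
      using ok'(3) st_event[OF v b] st_same[of b v] IH[OF v] v_notin by auto
    have "async_run F \<sigma> x ((b - 1) * n + Suc i) = ?X[v := st v (Suc b)]"
      using \<sigma>[OF b i] nb new by (simp add: v_def f_def)
    moreover have "take (Suc i) (ord b) = take i (ord b) @ [v]"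
      using i ord(4)[of b] by (simp add: take_Suc_conv_app_nth v_def)
    ultimately show ?case using IH v by (auto simp: nth_list_update n_def)
  qed
  have blocks: "\<forall>w<n. async_run F \<sigma> x (b * n) ! w = st w (Suc b)" for b
  proof (induction b)
    case 0
    then show ?case by (simp add: st_def)
  next
    case (Suc b)
    have "set (take n (ord (Suc b))) = {..<n}" using ord[of "Suc b"] by simp
    then show ?case using run[of "Suc b" n] Suc by (simp add: add.commute)
  qed
  let ?b = "\<beta> u q"
  \<comment> \<open>The witness for \<open>T\<close> is the end of the block in which
    \<open>q\<close> is entered.\<close>
  have "async_run F \<sigma> x (?b * n) ! u = q"
    using blocks[of ?b] st_event[of u ?b q] u q by (simp add: n_def)
  moreover have "?b * n > 0" using n q by simp
  ultimately show ?thesis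
    using scheme q(1) unfolding n_def[symmetric] by (intro exI[of _ \<sigma>] exI[of _ "?b * n"]) simp
qed

section \<open>From an update scheme to a certificate\<close>

lemma block_split:
  fixes n t :: nat
  assumes "0 < n" "1 \<le> b" "i < n" "t = (b - 1) * n + i"
  shows "t div n + 1 = b" "t mod n = i"
  using assms by auto

text \<open>A change made by step \<open>Suc t\<close> is dated block \<open>t div n + 1\<close>,
  position \<open>t mod n\<close>. Freezing makes each cell enter a state at most once, so one date
  per state records the whole run.\<close>

theorem certificate_complete:
  fixes F :: "'q::finite ca"
  assumes fr: "freezing F" and sch: "sequential_scheme (length x) \<sigma>"
    and u: "u < length x" and unst: "async_run F \<sigma> x T ! u \<noteq> x ! u"
  shows "\<exists>\<beta> \<pi>. certificate F x \<beta> \<pi> \<and> (\<exists>q. q \<noteq> x ! u \<and> \<beta> u q \<noteq> 0) \<and>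
    (\<forall>v<length x. \<forall>q. \<beta> v q \<le> length x * card (UNIV :: 'q set) \<and> \<pi> v q \<le> length x)"
proof -
  define n where "n = length x"
  define r where "r = radius F"
  define f where "f = local_fun F"
  define X where "X = async_run F \<sigma> x"
  have n: "0 < n" using u unfolding n_def by linarith
  have len: "length (X t) = n" for t by (simp add: X_def n_def)
  have X0: "X 0 = x" by (simp add: X_def)
  have X_Suc: "X (Suc t) = (X t)[\<sigma> (Suc t) := f (neighborhood F (X t) (\<sigma> (Suc t)))]" for t
    by (simp add: X_def f_def)
  have \<sigma>_less: "\<sigma> t < n" for t using sch by (simp add: sequential_scheme_def n_def)
  have bij: "bij_betw \<sigma> {(b - 1) * n + 1..b * n} {..<n}" if "b \<ge> 1" for b
    using sch that by (simp add: sequential_scheme_def n_def)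
  have block: "b * n = (b - 1) * n + n" if "b \<ge> 1" for b using that by (cases b) auto
  have upd_ex: "\<exists>i<n. \<sigma> (Suc ((b - 1) * n + i)) = v" if "b \<ge> 1" "v < n" for b v
  proof -
    have "v \<in> \<sigma> ` {(b - 1) * n + 1..b * n}" using bij[OF that(1)] that(2) by (simp add:
      bij_betw_def)
    then obtain t where t: "\<sigma> t = v" "t \<in> {(b - 1) * n + 1..b * n}" by blast
    have "t = Suc ((b - 1) * n + (t - 1 - (b - 1) * n))" "t - 1 - (b - 1) * n < n"
      using t(2) block[OF that(1)] n by auto
    then show ?thesis using t(1) by metis
  qed
  \<comment> \<open>A block and a cell determine the step, because a block is a permutation.\<close>
  have upd_inj: "t = t'" if "\<sigma> (Suc t) = \<sigma> (Suc t')" "t div n = t' div n" for t t'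
  proof -
    have mem: "Suc s \<in> {(Suc (s div n) - 1) * n + 1..Suc (s div n) * n}" for s
    proof -
      have "s div n * n + s mod n = s" "s mod n < n" using n by simp_all
      moreover have "(Suc (s div n) - 1) * n = s div n * n" "Suc (s div n) * n = n + s div n * n"
        by simp_all
      ultimately show ?thesis unfolding atLeastAtMost_iff by linarith
    qed
    have "inj_on \<sigma> {(Suc (t div n) - 1) * n + 1..Suc (t div n) * n}"
      using bij[of "Suc (t div n)"] by (simp add: bij_betw_def)
    from inj_onD[OF this that(1)] show ?thesis using mem[of t] mem[of t'] that(2) by simp
  qed
  obtain le where le: "reflp le" "antisymp le" "transp le"
    "\<And>x u. u < length x \<Longrightarrow> le (x ! u) (local_fun F (neighborhood F x u))"
    using fr unfolding freezing_def by blast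
  have step_le: "le (X t ! v) (X (Suc t) ! v)" if "v < n" for t v
  proof (cases "v = \<sigma> (Suc t)")
    case True
    then show ?thesis using le(4)[of v "X t"] that by (simp add: X_Suc len f_def)
  next
    case False
    then show ?thesis using le(1) by (simp add: X_Suc reflp_def)
  qed
  have mono: "le (X t ! v) (X t' ! v)" if "v < n" "t \<le> t'" for t t' v
    using that(2)
  proof (induction t' rule: dec_induct)
    case base
    then show ?case using le(1) by (simp add: reflp_def)
  next
    case (step m)
    then show ?case using step_le[OF that(1), of m] le(3) by (blast dest: transpD)
  qed
  define enters where "enters v q t \<longleftrightarrow> X t ! v \<noteq> q \<and> X (Suc t) ! v = q" for v q t
  have enters_\<sigma>: "\<sigma> (Suc t) = v" if "enters v q t" for v q t
    using that by (auto simp: enters_def X_Suc nth_list_update_neq intro: ccontr)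
  \<comment> \<open>The state at time \<open>t\<close> would lie both above and below
    \<open>q\<close>; antisymmetry concludes.\<close>
  have no_return: "X t ! v = q" if "v < n" "t0 \<le> t" "X t0 ! v = q" "enters v q t" for v q t0 t
  proof -
    have "le q (X t ! v)" using mono[OF that(1,2)] that(3) by simp
    moreover have "le (X t ! v) q" using step_le[OF that(1), of t] that(4) by (simp add: enters_def)
    ultimately show ?thesis using le(2) by (simp add: antisymp_def)
  qed
  have enters_init: "\<not> enters v (x ! v) t" if "v < n" for v t
    using no_return[OF that, of 0 t "x ! v"] by (auto simp: X0 enters_def)
  have enters_unique: "t = t'" if "v < n" "enters v q t" "enters v q t'" for v q t t'
  proof -
    have "\<not> a < b" if "enters v q a" "enters v q b" for a b
      using no_return[OF \<open>v < n\<close>, of "Suc a" b q] that by (auto simp: enters_def)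
    then show ?thesis using that(2,3) by (metis linorder_neq_iff)
  qed
  have cur: "X t ! v = X a ! v \<or> (\<exists>t'. a \<le> t' \<and> t' < t \<and> enters v (X t ! v) t')" if "a \<le> t" for a
    t v
    using that
  proof (induction t rule: dec_induct)
    case (step m)
    show ?case
    proof (cases "X (Suc m) ! v = X m ! v")
      case True
      then show ?thesis using step.IH by (auto intro: less_SucI)
    next
      case False
      then have "enters v (X (Suc m) ! v) m" by (simp add: enters_def)
      then show ?thesis using step.hyps by auto
    qed
  qed simp
  define time where "time v q = (THE t. enters v q t)" for v q
  have time: "time v q = t" if "v < n" "enters v q t" for v q t
    unfolding time_def using that enters_unique by blast
  define \<beta> where "\<beta> v q = (if \<exists>t. enters v q t then time v q div n + 1 else 0)" for v q
  define \<pi> where "\<pi> v q = (if \<exists>t. enters v q t then time v q mod n else if q = x ! v then 1 else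
    0)" for v q
  have \<beta>_enters: "\<beta> v q = t div n + 1 \<and> \<pi> v q = t mod n" if "v < n" "enters v q t" for v q t
    using that time[OF that] by (auto simp: \<beta>_def \<pi>_def)
  have \<beta>_pos: "\<exists>t. enters v q t \<and> \<beta> v q = t div n + 1 \<and> \<pi> v q = t mod n" if "v < n" "\<beta> v q \<noteq> 0"
    for v q
  proof -
    have "\<exists>t. enters v q t" using that(2) by (auto simp: \<beta>_def split: if_splits)
    then show ?thesis using \<beta>_enters[OF that(1)] by blast
  qed
  have \<beta>_0: "\<pi> v q = (if q = x ! v then 1 else 0)" if "\<beta> v q = 0" for v q
    using that by (auto simp: \<beta>_def \<pi>_def split: if_splits)
  have \<beta>_init: "\<beta> v (x ! v) = 0" if "v < n" for v using enters_init[OF that] by (simp add: \<beta>_def)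
  \<comment> \<open>Turns the order of steps into the lexicographic order used in
    \<open>start_state_at\<close>.\<close>
  have lex: "t' div n < t div n \<or> t' div n = t div n \<and> t' mod n < t mod n" if "t' < t" for t t' ::
    nat
  proof (cases "t' div n = t div n")
    case True
    then show ?thesis using that mult_div_mod_eq[of n t] mult_div_mod_eq[of n t'] by (metis
      nat_add_left_cancel_less)
  next
    case False
    then show ?thesis using div_le_mono[of t' t n] that by linarith
  qed
  have start: "start_state_at (\<beta> v) (\<pi> v) b (X ((b - 1) * n) ! v)" if v: "v < n" and b: "b \<ge> 1"
    for v b
  proof -
    define a where "a = (b - 1) * n"
    define s where "s = X a ! v"
    have a_div: "t div n + 1 < b" if "t < a" for t
      using that n b div_less_iff_less_mult[of n t "b - 1"] by (simp add: a_def)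
    have s_cases: "s = x ! v \<or> (\<exists>t<a. enters v s t)" using cur[of 0 a v] by (auto simp: s_def X0)
    have s_less: "\<beta> v s < b"
      using s_cases \<beta>_init[OF v] b \<beta>_enters[OF v] a_div by auto
    have "\<beta> v s' < \<beta> v s \<or> \<beta> v s' = \<beta> v s \<and> \<pi> v s' < \<pi> v s" if s': "s' \<noteq> s" "\<beta> v s' < b" for s'
    proof (cases "\<beta> v s' = 0")
      case True
      show ?thesis
      proof (cases "s = x ! v")
        case s: True
        then have "\<beta> v s = 0" using \<beta>_init[OF v] by simp
        then show ?thesis using True \<beta>_0[of v s] \<beta>_0[of v s'] s s' by auto
      next
        case False
        then obtain t where "enters v s t" using s_cases by blast
        then have "\<beta> v s \<noteq> 0" using \<beta>_enters[OF v] by simp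
        then show ?thesis using True by simp
      qed
    next
      case False
      then obtain t' where t': "enters v s' t'" "\<beta> v s' = t' div n + 1" "\<pi> v s' = t' mod n"
        using \<beta>_pos[OF v] by blast
      have t'a: "t' < a"
      proof -
        have "t' div n < b - 1" using t'(2) s'(2) by simp
        then show ?thesis using n by (simp add: a_def div_less_iff_less_mult)
      qed
      show ?thesis
      proof (cases "s = x ! v")
        case True
        \<comment> \<open>Here \<open>s'\<close> would lie between two occurrences of the initial
          state and thus equal it.\<close>
        have "le s' s" using mono[OF v, of "Suc t'" a] t' t'a by (simp add: enters_def s_def)
        moreover have "le s s'" using mono[OF v, of 0 "Suc t'"] True t' by (simp add: X0 enters_def)
        ultimately show ?thesis using s' le(2) by (simp add: antisymp_def)
      next
        case False
        then obtain t where t: "t < a" "enters v s t" using s_cases by blast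
        have "t' < t"
        proof (rule ccontr)
          assume "\<not> t' < t"
          moreover have "t' \<noteq> t" using t t' s' by (auto simp: enters_def)
          ultimately have "t < t'" by simp
          then have "le s s'" using mono[OF v, of "Suc t" "Suc t'"] t t' by (simp add: enters_def)
          moreover have "le s' s" using mono[OF v, of "Suc t'" a] t' t'a by (simp add: enters_def
            s_def)
          ultimately show False using s' le(2) by (simp add: antisymp_def)
        qed
        from lex[OF this] show ?thesis using \<beta>_enters[OF v t(2)] t'(2,3) by simp
      qed
    qed
    then show ?thesis using s_less unfolding start_state_at_def s_def a_def by blast
  qed
  have st: "state_at (\<beta> v) (\<pi> v) b i (X ((b - 1) * n + i) ! v)" if v: "v < n" and b: "b \<ge> 1" and
    i: "i < n" for v b i
  proof (cases "\<exists>s'. \<beta> v s' = b \<and> \<pi> v s' < i")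
    case True
    then obtain s' where s': "\<beta> v s' = b" "\<pi> v s' < i" by blast
    then obtain t' where t': "enters v s' t'" "b = t' div n + 1" "\<pi> v s' = t' mod n"
      using \<beta>_pos[OF v, of s'] b by auto
    define t where "t = (b - 1) * n + i"
    have "t' = (b - 1) * n + t' mod n" using t'(2) by simp
    then have t'_less: "Suc t' \<le> t" using s'(2) t'(3) unfolding t_def by linarith
    \<comment> \<open>At \<open>t'\<close> the cell has spent its only update of this block.\<close>
    have "\<not> enters v q t''" if "Suc t' \<le> t''" "t'' < t" for q t''
    proof
      assume en: "enters v q t''"
      have "t'' div n \<le> (t - 0) div n" using that by (intro div_le_mono) simp
      moreover have "t div n = b - 1" using block_split(1)[OF n b i t_def] by simp
      moreover have "t' div n \<le> t'' div n" using that by (intro div_le_mono) simp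
      ultimately have "t'' div n = t' div n" using t'(2) by simp
      then have "t'' = t'" using upd_inj enters_\<sigma>[OF en] enters_\<sigma>[OF t'(1)] by metis
      then show False using that by simp
    qed
    then have "X t ! v = X (Suc t') ! v" using cur[OF t'_less, of v] by blast
    then have "X t ! v = s'" using t' by (simp add: enters_def)
    then show ?thesis using s' unfolding state_at_def t_def by simp
  next
    case False
    define t where "t = (b - 1) * n + i"
    have "\<not> enters v q t'" if lo: "(b - 1) * n \<le> t'" and hi: "t' < t" for q t'
    proof
      assume en: "enters v q t'"
      obtain j where j: "t' = (b - 1) * n + j" using le_Suc_ex[OF lo] by blast
      have "j < i" using hi j by (simp add: t_def)
      then have "\<beta> v q = b \<and> \<pi> v q = j" using \<beta>_enters[OF v en] block_split[OF n b _ j] i by simp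
      then show False using False \<open>j < i\<close> by blast
    qed
    then have "X t ! v = X ((b - 1) * n) ! v" using cur[of "(b - 1) * n" t v] unfolding t_def by
      auto
    then show ?thesis using start[OF v b] False unfolding state_at_def t_def by simp
  qed
  let ?c = "cell n r"
  have nb: "neighborhood F (X t) v = map (\<lambda>d. X t ! ?c v d) [0..<2 * r + 1]" for t v
    by (simp add: neighborhood_cell len r_def)
  have new: "X (Suc t) ! \<sigma> (Suc t) = f (neighborhood F (X t) (\<sigma> (Suc t)))" for t
    using \<sigma>_less by (simp add: X_Suc len)
  have upd: "\<exists>\<rho> g. update_ok f r (\<lambda>d. \<beta> (?c v d)) (\<lambda>d. \<pi> (?c v d)) b \<rho> g" if v: "v < n" and b: "b
    \<ge> 1" for v b
  proof -
    obtain i where i: "i < n" "\<sigma> (Suc ((b - 1) * n + i)) = v" using upd_ex[OF b v] by blast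
    define t where "t = (b - 1) * n + i"
    define g where "g = neighborhood F (X t) v"
    have tb: "t div n + 1 = b" "t mod n = i" using block_split[OF n b i(1) t_def] .
    have fg: "X (Suc t) ! v = f g" using new[of t] i(2) by (simp add: g_def t_def)
    have glen: "length g = 2 * r + 1" by (simp add: g_def nb)
    have gd: "g ! d = X t ! ?c v d" if "d < 2 * r + 1" for d using that by (simp add: g_def nb
      del: upt_Suc)
    have "state_at (\<beta> (?c v d)) (\<pi> (?c v d)) b i (g ! d)" if "d < 2 * r + 1" for d
      using st[OF cell_less[OF n] b i(1)] gd[OF that] by (simp add: t_def)
    moreover have "(\<exists>q. \<beta> v q = b \<and> \<pi> v q = i \<and> f g = q) \<or> (\<forall>q. \<beta> v q \<noteq> b) \<and> f g = g ! r"
    proof (cases "X (Suc t) ! v = X t ! v")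
      case False
      then have "enters v (f g) t" by (simp add: enters_def fg)
      then show ?thesis using \<beta>_enters[OF v] tb by auto
    next
      case True
      have "\<beta> v q \<noteq> b" for q
      proof
        assume q: "\<beta> v q = b"
        then obtain t' where t': "enters v q t'" "b = t' div n + 1" using \<beta>_pos[OF v, of q] b by
          auto
        then have "t' div n = t div n" using tb(1) by simp
        moreover have "\<sigma> (Suc t') = \<sigma> (Suc t)" using enters_\<sigma>[OF t'(1)] i(2) by (simp add: t_def)
        ultimately have "t' = t" using upd_inj by blast
        then show False using t'(1) True by (simp add: enters_def)
      qed
      then show ?thesis using True fg gd[of r] v by (simp add: cell_center)
    qed
    ultimately have "update_ok f r (\<lambda>d. \<beta> (?c v d)) (\<lambda>d. \<pi> (?c v d)) b i g"
      using glen v by (simp add: update_ok_def cell_center)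
    then show ?thesis by blast
  qed
  have cert: "certificate F x \<beta> \<pi>"
    unfolding certificate_def Let_def
  proof (intro allI impI)
    fix v assume "v < length x"
    then have v: "v < n" by (simp add: n_def)
    have "\<pi> v q = 0" if "q \<noteq> x ! v" "\<beta> v q = 0" for q using \<beta>_0[OF that(2)] that(1) by simp
    moreover have "\<pi> v (x ! v) = 1" using \<beta>_0[OF \<beta>_init[OF v]] by simp
    moreover have "\<beta> v q = 0" if ne: "q \<noteq> q'" and eq: "\<beta> v q = \<beta> v q'" for q q'
    proof (rule ccontr)
      assume nz: "\<beta> v q \<noteq> 0"
      obtain t where t: "enters v q t" "\<beta> v q = t div n + 1" using \<beta>_pos[OF v nz] by blast
      obtain t' where t': "enters v q' t'" "\<beta> v q' = t' div n + 1" using \<beta>_pos[OF v, of q'] nz eq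
        by auto
      have "t div n = t' div n" using t(2) t'(2) eq by simp
      moreover have "\<sigma> (Suc t) = \<sigma> (Suc t')" using enters_\<sigma>[OF t(1)] enters_\<sigma>[OF t'(1)] by simp
      ultimately have "t = t'" using upd_inj by blast
      then show False using t(1) t'(1) ne by (simp add: enters_def)
    qed
    moreover have "v = w" if w: "w < n" and eq: "\<beta> v q = \<beta> w q'" "\<beta> v q \<noteq> 0" "\<pi> v q = \<pi> w q'" for
      w q q'
    proof -
      obtain t where t: "enters v q t" "\<beta> v q = t div n + 1" "\<pi> v q = t mod n" using \<beta>_pos[OF v
        eq(2)] by blast
      obtain t' where t': "enters w q' t'" "\<beta> w q' = t' div n + 1" "\<pi> w q' = t' mod n"
        using \<beta>_pos[OF w, of q'] eq(1,2) by auto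
      have "t div n = t' div n" "t mod n = t' mod n" using t t' eq by auto
      then have "t = t'" by (metis div_mult_mod_eq)
      then show ?thesis using enters_\<sigma>[OF t(1)] enters_\<sigma>[OF t'(1)] by simp
    qed
    ultimately have "window_ok f r (x ! v) (\<lambda>d. \<beta> (?c v d)) (\<lambda>d. \<pi> (?c v d)) (?c v)"
      using \<beta>_init[OF v] upd[OF v] cell_less[OF n] v unfolding window_ok_def
      by (simp add: cell_center)
    then show "window_ok (local_fun F) (radius F) (x ! v) (\<lambda>d. \<beta> (cell (length x) (radius F) v d))
        (\<lambda>d. \<pi> (cell (length x) (radius F) v d)) (cell (length x) (radius F) v)"
      by (simp add: n_def r_def f_def)
  qed
  have un: "n > u" using u by (simp add: n_def)
  have "\<exists>t'. enters u (X T ! u) t'" using cur[of 0 T u] unst by (auto simp: X_def)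
  then have change: "\<exists>q. q \<noteq> x ! u \<and> \<beta> u q \<noteq> 0"
    using \<beta>_enters[OF un] unst by (auto simp: X_def)
  \<comment> \<open>A block without changes starts in a fixed point.\<close>
  have active: "\<exists>w<n. \<exists>s. \<beta> w s = c" if v: "v < n" "\<beta> v q = b" and c: "1 \<le> c" "c \<le> b" for v q b c
  proof (rule ccontr)
    assume none: "\<not> (\<exists>w<n. \<exists>s. \<beta> w s = c)"
    define a where "a = (c - 1) * n"
    have const: "X (a + i) = X a" if "i < n" for i
    proof (rule nth_equalityI)
      fix w assume "w < length (X (a + i))"
      then have w: "w < n" by (simp add: len)
      have "\<not> enters w s t'" if lo: "a \<le> t'" and hi: "t' < a + i" for s t'
      proof
        assume en: "enters w s t'"
        obtain j where j: "t' = (c - 1) * n + j" using le_Suc_ex[OF lo] unfolding a_def by blast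
        have "j < n" using hi j \<open>i < n\<close> by (simp add: a_def)
        then have "\<beta> w s = c" using \<beta>_enters[OF w en] block_split[OF n c(1) _ j] by simp
        then show False using none w by blast
      qed
      then show "X (a + i) ! w = X a ! w" using cur[of a "a + i" w] by auto
    qed (simp add: len)
    have fix_: "f (neighborhood F (X a) w) = X a ! w" if w: "w < n" for w
    proof -
      obtain i where i: "i < n" "\<sigma> (Suc (a + i)) = w" using upd_ex[OF c(1) w] by (auto simp: a_def)
      have "\<not> enters w s (a + i)" for s
      proof
        assume en: "enters w s (a + i)"
        have "\<beta> w s = c" using \<beta>_enters[OF w en] block_split[OF n c(1) i(1)] by (simp add: a_def)
        then show False using none w by blast
      qed
      from this[of "X (Suc (a + i)) ! w"] have "X (Suc (a + i)) ! w = X (a + i) ! w"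
        by (auto simp: enters_def)
      then show ?thesis using new[of "a + i"] i const[OF i(1)] by simp
    qed
    have all: "X (a + i) = X a" for i
    proof (induction i)
      case (Suc i)
      have "X (a + Suc i) = (X a)[\<sigma> (Suc (a + i)) := X a ! \<sigma> (Suc (a + i))]"
        using X_Suc[of "a + i"] Suc fix_[OF \<sigma>_less] by simp
      then show ?case by simp
    qed simp
    have "\<beta> v q \<noteq> 0" using v c by simp
    then obtain t where t: "enters v q t" "\<beta> v q = t div n + 1" using \<beta>_pos[OF v(1)] by blast
    have "c - 1 \<le> t div n" using t(2) v(2) c by simp
    then have "(c - 1) * n \<le> t div n * n" by (rule mult_le_mono1)
    also have "\<dots> \<le> t" by simp
    finally have "a \<le> t" by (simp only: a_def)
    then obtain j where "t = a + j" using le_Suc_ex by blast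
    then show False using t(1) all[of j] all[of "Suc j"] by (simp add: enters_def)
  qed
  \<comment> \<open>By \<open>active\<close> all numbers from 1 to \<open>\<beta> v q\<close> are
    values of \<open>\<beta>\<close> on the \<open>n * card UNIV\<close> pairs of a cell and a
    state.\<close>
  have bound: "\<beta> v q \<le> n * card (UNIV :: 'q set)" if v: "v < n" for v q
  proof -
    let ?A = "{..<n} \<times> (UNIV :: 'q set)"
    have "{1..\<beta> v q} \<subseteq> (\<lambda>(w, s). \<beta> w s) ` ?A"
    proof
      fix c assume "c \<in> {1..\<beta> v q}"
      then have "1 \<le> c" "c \<le> \<beta> v q" by simp_all
      from active[OF v refl this] obtain w s where "w < n" "\<beta> w s = c" by blast
      then show "c \<in> (\<lambda>(w, s). \<beta> w s) ` ?A" by force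
    qed
    then have "card {1..\<beta> v q} \<le> card ?A" by (intro surj_card_le) simp_all
    then show ?thesis by (simp add: card_cartesian_product)
  qed
  have "\<pi> v q \<le> n" for v q using n by (auto simp: \<pi>_def less_imp_le)
  then show ?thesis using cert change bound unfolding n_def by blast
qed

section \<open>A register machine checking certificates\<close>

text \<open>If the centre does not change, \<open>b\<close> and \<open>\<rho>\<close> enter only
  through comparisons with recorded times, so they can move freely within a gap between
  these.\<close>

lemma update_ok_cong:
  assumes eq: "\<And>d s. d < 2 * r + 1 \<Longrightarrow> B d s < b \<longleftrightarrow> B d s < b'"
    "\<And>d s. d < 2 * r + 1 \<Longrightarrow> B d s = b \<and> P d s < \<rho> \<longleftrightarrow> B d s = b' \<and> P d s < \<rho>'"
    "\<And>q. B r q \<noteq> b'" and ok: "update_ok f r B P b \<rho> g" "\<And>q. B r q \<noteq> b"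
  shows "update_ok f r B P b' \<rho>' g"
proof -
  have "state_at (B d) (P d) b' \<rho>' s" if "d < 2 * r + 1" "state_at (B d) (P d) b \<rho> s" for d s
    using that(2) eq(1,2)[OF that(1)] unfolding state_at_def start_state_at_def by simp
  then show ?thesis using ok eq(3) unfolding update_ok_def by simp
qed

text \<open>
  Only finitely many moments \<open>\<rho>\<close> and blocks \<open>b\<close> need to be tried, since the states in the window
  change only at the recorded times.
\<close>

definition update_check :: "('q list \<Rightarrow> 'q) \<Rightarrow> nat \<Rightarrow> (nat \<Rightarrow> 'q \<Rightarrow> nat) \<Rightarrow> (nat \<Rightarrow> 'q \<Rightarrow> nat) \<Rightarrow> nat \<Rightarrow>
  bool" where
  "update_check f r B P b \<longleftrightarrow> (\<exists>g. update_ok f r B P b 0 g) \<or>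
     (\<exists>d\<in>{..<2 * r + 1}. \<exists>q. (\<exists>g. update_ok f r B P b (P d q) g) \<or> (\<exists>g. update_ok f r B P b (Suc
       (P d q)) g))"

text \<open>A change of the centre forces \<open>\<rho>\<close> to be its recorded position.
  Otherwise \<open>\<rho>\<close> can be lowered to just after the last preceding change in this
  block, or to 0 if there is none.\<close>

lemma update_check_iff:
  fixes f :: "'q::finite list \<Rightarrow> 'q"
  shows "update_check f r B P b \<longleftrightarrow> (\<exists>\<rho> g. update_ok f r B P b \<rho> g)"
proof
  assume "\<exists>\<rho> g. update_ok f r B P b \<rho> g"
  then obtain \<rho> g where ok: "update_ok f r B P b \<rho> g" by blast
  show "update_check f r B P b"
  proof (cases "\<exists>q. B r q = b")
    case True
    then obtain q where "P r q = \<rho>" using ok by (auto simp: update_ok_def)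
    then show ?thesis unfolding update_check_def using ok
      by (intro disjI2 bexI[of _ r] exI[of _ q] disjI1 exI[of _ g]) simp_all
  next
    case False
    then have no: "\<And>q. B r q \<noteq> b" by blast
    define E where "E = {P d s | d s. d < 2 * r + 1 \<and> B d s = b \<and> P d s < \<rho>}"
    have "finite E"
      by (rule finite_subset[of _ "(\<lambda>(d, s). P d s) ` ({..<2 * r + 1} \<times> UNIV)"]) (auto simp: E_def)
    show ?thesis
    proof (cases "E = {}")
      case True
      then have "update_ok f r B P b 0 g"
        by (intro update_ok_cong[OF _ _ no ok no]) (auto simp: E_def)
      then show ?thesis unfolding update_check_def by blast
    next
      case False
      have "Max E \<in> E" using \<open>finite E\<close> False by (rule Max_in)
      then obtain d s where ds: "Max E = P d s" "d < 2 * r + 1" "P d s < \<rho>" by (auto simp: E_def)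
      have "P d' s' < \<rho> \<longleftrightarrow> P d' s' < Suc (P d s)" if "d' < 2 * r + 1" "B d' s' = b" for d' s'
      proof
        assume "P d' s' < \<rho>"
        then have "P d' s' \<in> E" using that by (auto simp: E_def)
        then show "P d' s' < Suc (P d s)" using Max_ge[OF \<open>finite E\<close>] ds(1) by fastforce
      qed (use ds in simp)
      then have "update_ok f r B P b (Suc (P d s)) g"
        by (intro update_ok_cong[OF _ _ no ok no]) auto
      then show ?thesis unfolding update_check_def using ds(2) by blast
    qed
  qed
qed (auto simp: update_check_def)

definition window_check :: "('q list \<Rightarrow> 'q) \<Rightarrow> nat \<Rightarrow> 'q \<Rightarrow> (nat \<Rightarrow> 'q \<Rightarrow> nat) \<Rightarrow> (nat \<Rightarrow> 'q \<Rightarrow> nat) \<Rightarrow> (nat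
  \<Rightarrow> nat) \<Rightarrow> bool" where
  "window_check f r q0 B P I \<longleftrightarrow>
     B r q0 = 0 \<and> P r q0 = 1 \<and> (\<forall>q. q \<noteq> q0 \<longrightarrow> B r q = 0 \<longrightarrow> P r q = 0) \<and>
     (\<forall>q q'. q \<noteq> q' \<longrightarrow> B r q = B r q' \<longrightarrow> B r q = 0) \<and>
     (\<forall>d\<in>{..<2 * r + 1}. \<forall>q q'. B r q = B d q' \<longrightarrow> B r q \<noteq> 0 \<longrightarrow> P r q = P d q' \<longrightarrow> I r = I d) \<and>
     (\<forall>d\<in>{..<2 * r + 1}. \<forall>q. (B d q \<noteq> 0 \<longrightarrow> update_check f r B P (B d q)) \<and> update_check f r B P
       (Suc (B d q)))"

text \<open>A block in which the window records nothing can be replaced by the successor of the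
  greatest recorded block below it. There is one below, since \<open>q0\<close> is recorded in block
  0.\<close>

lemma window_check_iff:
  fixes f :: "'q::finite list \<Rightarrow> 'q"
  shows "window_check f r q0 B P I \<longleftrightarrow> window_ok f r q0 B P I"
proof -
  let ?U = "update_check f r B P"
  have "(\<forall>b\<ge>1. ?U b) \<longleftrightarrow> (\<forall>d\<in>{..<2 * r + 1}. \<forall>q. (B d q \<noteq> 0 \<longrightarrow> ?U (B d q)) \<and> ?U (Suc (B d q)))"
    if q0: "B r q0 = 0"
  proof
    assume R: "\<forall>d\<in>{..<2 * r + 1}. \<forall>q. (B d q \<noteq> 0 \<longrightarrow> ?U (B d q)) \<and> ?U (Suc (B d q))"
    show "\<forall>b\<ge>1. ?U b"
    proof (intro allI impI)
      fix b :: nat assume b: "b \<ge> 1"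
      show "?U b"
      proof (cases "\<exists>d<2 * r + 1. \<exists>q. B d q = b")
        case True
        then show ?thesis using R b by auto
      next
        case False
        define E where "E = {B d s | d s. d < 2 * r + 1 \<and> B d s < b}"
        have fin: "finite E" by (rule finite_subset[of _ "{..<b}"]) (auto simp: E_def)
        have "B r q0 \<in> E" using q0 b by (auto simp: E_def intro!: exI[of _ r] exI[of _ q0])
        then have "Max E \<in> E" using fin Max_in by blast
        then obtain d s where ds: "Max E = B d s" "d < 2 * r + 1" "B d s < b" by (auto simp: E_def)
        have gap: "B d' s' < Suc (B d s) \<longleftrightarrow> B d' s' < b" if "d' < 2 * r + 1" for d' s'
        proof
          assume "B d' s' < b"
          then have "B d' s' \<in> E" using that by (auto simp: E_def)
          then show "B d' s' < Suc (B d s)" using Max_ge[OF fin] ds(1) by fastforce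
        qed (use ds in simp)
        have noS: "B d' s' \<noteq> Suc (B d s)" if "d' < 2 * r + 1" for d' s'
        proof
          assume eq: "B d' s' = Suc (B d s)"
          then have "\<not> B d' s' < b" using gap[OF that, of s'] by simp
          then have "B d' s' = b" using eq ds(3) by simp
          then show False using False that by blast
        qed
        obtain \<rho> g where ok: "update_ok f r B P (Suc (B d s)) \<rho> g"
          using R ds(2) unfolding update_check_iff by blast
        have "update_ok f r B P b \<rho> g"
          by (rule update_ok_cong[OF gap _ _ ok]) (use noS False in auto)
        then show ?thesis unfolding update_check_iff by blast
      qed
    qed
  qed auto
  then show ?thesis unfolding window_check_def window_ok_def update_check_iff
    by (auto simp only: Ball_def lessThan_iff)
qed

section \<open>The window check is recognised by finite automata\<close>

lemma recog_all: "(\<And>q. recog D (P q)) \<Longrightarrow> recog D (\<lambda>z. \<forall>q::'q::finite. P q z)"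
  using recog_ball[of UNIV D P] by simp

lemma recog_ex: "(\<And>q. recog D (P q)) \<Longrightarrow> recog D (\<lambda>z. \<exists>q::'q::finite. P q z)"
  using recog_bex[of UNIV D P] by simp

text \<open>Treats alike the three kinds of moments and blocks that are tried: 0, a register, and
  the successor of a register.\<close>

definition recog_term :: "nat \<Rightarrow> (('v \<Rightarrow> nat) \<Rightarrow> nat) \<Rightarrow> bool" where
  "recog_term D t \<longleftrightarrow> (\<forall>w. recog D (\<lambda>z. z w < t z)) \<and> (\<forall>w. recog D (\<lambda>z. z w = t z))"

lemma recog_term_reg: "recog_term D (\<lambda>z. z v)"
  by (simp add: recog_term_def recog_less recog_eq)

lemma recog_term_Suc: "recog_term D (\<lambda>z. Suc (z v))"
proof -
  have "recog D (\<lambda>z. z w < Suc (z v))" for w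
    using recog_not[OF recog_less[of D v w]] by (simp only: not_less less_Suc_eq_le)
  then show ?thesis by (simp add: recog_term_def recog_eq_Suc)
qed

lemma recog_term_0: "recog_term D (\<lambda>z. 0)"
  using recog_const[of D False] by (simp add: recog_term_def recog_eq_const)

lemma recog_term_less: "recog_term D t \<Longrightarrow> recog D (\<lambda>z. z w < t z)"
  by (simp add: recog_term_def)

lemma recog_term_eq: "recog_term D t \<Longrightarrow> recog D (\<lambda>z. z w = t z)"
  by (simp add: recog_term_def)

lemma recog_update:
  fixes f :: "'q::finite list \<Rightarrow> 'q"
  assumes b: "recog_term D b" and \<rho>: "recog_term D \<rho>"
  shows "recog D (\<lambda>z. \<exists>g. update_ok f r (\<lambda>d q. z (vb d q)) (\<lambda>d q. z (vp d q)) (b z) (\<rho> z) g)"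
proof -
  have start: "recog D (\<lambda>z. start_state_at (\<lambda>q. z (vb d q)) (\<lambda>q. z (vp d q)) (b z) s)" for d s
    unfolding start_state_at_def
    by (intro recog_conj recog_disj recog_imp recog_all recog_less recog_eq recog_term_less[OF b]
      recog_const)
  have st: "recog D (\<lambda>z. state_at (\<lambda>q. z (vb d q)) (\<lambda>q. z (vp d q)) (b z) (\<rho> z) s)" for d s
    unfolding state_at_def
    by (intro recog_conj recog_disj recog_not recog_all start recog_term_less[OF \<rho>]
      recog_term_eq[OF b])
  have fin: "finite {g :: 'q list. length g = 2 * r + 1}"
    using finite_lists_length_eq[of "UNIV :: 'q set" "2 * r + 1"] by simp
  have "recog D (\<lambda>z. \<exists>g\<in>{g. length g = 2 * r + 1}.
      (\<forall>d\<in>{..<2 * r + 1}. state_at (\<lambda>q. z (vb d q)) (\<lambda>q. z (vp d q)) (b z) (\<rho> z) (g ! d)) \<and>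
      ((\<exists>q. z (vb r q) = b z \<and> z (vp r q) = \<rho> z \<and> f g = q) \<or> (\<forall>q. \<not> z (vb r q) = b z) \<and> f g = g !
        r))"
    by (intro recog_bex recog_ball recog_conj recog_disj recog_not recog_all recog_ex st fin
      finite_lessThan
        recog_term_eq[OF \<rho>] recog_term_eq[OF b] recog_const)
  then show ?thesis unfolding update_ok_def by (simp add: Bex_def Ball_def conj_assoc)
qed

lemma recog_window_check:
  fixes f :: "'q::finite list \<Rightarrow> 'q"
  shows "recog D (\<lambda>z. window_check f r q0 (\<lambda>d q. z (vb d q)) (\<lambda>d q. z (vp d q)) (\<lambda>d. z (vi d)))"
proof -
  have U: "recog D (\<lambda>z. update_check f r (\<lambda>d q. z (vb d q)) (\<lambda>d q. z (vp d q)) (b z))"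
    if "recog_term D b" for b
    unfolding update_check_def
    by (intro recog_disj recog_bex recog_ex finite_lessThan recog_update that recog_term_0
        recog_term_reg recog_term_Suc)
  show ?thesis unfolding window_check_def
    by (intro recog_conj recog_ball recog_all recog_imp recog_not finite_lessThan recog_const
        recog_eq recog_eq_const U recog_term_reg recog_term_Suc)
qed

section \<open>Registers and the transition relation\<close>

datatype 'q slot_field = FIdx | FB 'q | FP 'q

text \<open>\<open>Slot True\<close> is the saved first window and \<open>Slot False\<close> the
  sliding one. \<open>NumU\<close> holds the guessed cell and \<open>NumV\<close> the value of its
  notation read so far.\<close>

datatype 'q reg = Phase | NumN | NumU | NumV | Idx | Slot bool nat "'q slot_field"

lemma finite_slot_field: "finite (UNIV :: 'q::finite slot_field set)"
proof -
  have "x \<in> {FIdx} \<union> range FB \<union> range FP" for x :: "'q slot_field" by (cases x) auto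
  then have "(UNIV :: 'q slot_field set) \<subseteq> {FIdx} \<union> range FB \<union> range FP" by blast
  then show ?thesis by (rule finite_subset) simp
qed

instance slot_field :: (finite) finite
  by standard (rule finite_slot_field)

definition regs :: "nat \<Rightarrow> 'q reg set" where
  "regs r = {Phase, NumN, NumU, NumV, Idx} \<union> (\<lambda>(c, d, g). Slot c d g) ` (UNIV \<times> {..<2 * r + 1} \<times>
    UNIV)"

lemma finite_regs: "finite (regs r :: 'q::finite reg set)"
  by (simp add: regs_def)

text \<open>
  The register \<^const>\<open>Phase\<close> tells which part of the input is being read: the first digit of \<open>n\<close> (0), its
  other digits (1), the configuration (2), the first digit of \<open>u\<close> (3), its other digits (4), or the
  end of the input after \<open>u = 0\<close> (5). The cell \<open>u\<close> is guessed at the first separator and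
  compared with its binary notation at the end.
\<close>

fun step_rel :: "'q ca \<Rightarrow> 'q symbol input_symbol \<Rightarrow> ('q reg \<Rightarrow> nat) \<Rightarrow> ('q reg \<Rightarrow> nat) \<Rightarrow> bool" where
  "step_rel F Left_End x y \<longleftrightarrow> (\<forall>v\<in>regs (radius F). y v = 0)"
| "step_rel F (Letter (Bit b)) x y \<longleftrightarrow>
     x Phase = 0 \<and> b \<and> y Phase = 1 \<and> y NumN = 1 \<or>
     x Phase = 1 \<and> y Phase = 1 \<and> y NumN = 2 * x NumN + of_bool b \<or>
     x Phase = 3 \<and> y NumU = x NumU \<and> y Phase = (if b then 4 else 5) \<and> y NumV = of_bool b \<or>
     x Phase = 4 \<and> y NumU = x NumU \<and> y Phase = 4 \<and> y NumV = 2 * x NumV + of_bool b"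
| "step_rel F (Letter Separator) x y \<longleftrightarrow>
     x Phase = 1 \<and> y Phase = 2 \<and> y NumN = x NumN \<and> y Idx = 0 \<and> y NumU < y NumN \<and>
       (\<forall>d\<in>{..<2 * radius F + 1}. \<forall>g. y (Slot True d g) = y (Slot False d g)) \<or>
     x Phase = 2 \<and> y Phase = 3 \<and> y NumU = x NumU \<and> x Idx = x NumN \<and>
       (\<forall>d\<in>{..<2 * radius F + 1}. \<forall>g. x (Slot True d g) = x (Slot False d g))"
| "step_rel F (Letter (State q)) x y \<longleftrightarrow>
     x Phase = 2 \<and> y Phase = 2 \<and> y NumN = x NumN \<and> y NumU = x NumU \<and> y Idx = Suc (x Idx) \<and>
     (\<forall>d\<in>{..<2 * radius F + 1}. \<forall>g. y (Slot True d g) = x (Slot True d g)) \<and>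
     (\<forall>d\<in>{..<2 * radius F}. \<forall>g. y (Slot False d g) = x (Slot False (Suc d) g)) \<and>
     x (Slot False (radius F) FIdx) = x Idx \<and>
     window_check (local_fun F) (radius F) q (\<lambda>d s. x (Slot False d (FB s))) (\<lambda>d s. x (Slot False
       d (FP s)))
       (\<lambda>d. x (Slot False d FIdx)) \<and>
     (x NumU = x Idx \<longrightarrow> (\<exists>s. s \<noteq> q \<and> \<not> x (Slot False (radius F) (FB s)) = 0))"
| "step_rel F Right_End x y \<longleftrightarrow> (x Phase = 4 \<or> x Phase = 5) \<and> x NumV = x NumU"

lemma recog_step_rel:
  fixes F :: "'q::finite ca"
  shows "recog D (\<lambda>z. step_rel F a (\<lambda>v. z (False, v)) (\<lambda>v. z (True, v)))"
proof (cases a)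
  case Left_End
  show ?thesis unfolding Left_End step_rel.simps
    by (intro recog_ball finite_regs recog_eq_const)
next
  case Right_End
  show ?thesis unfolding Right_End step_rel.simps
    by (intro recog_conj recog_disj recog_eq_const recog_eq)
next
  case (Letter l)
  show ?thesis
  proof (cases l)
    case (Bit b)
    show ?thesis unfolding Letter Bit step_rel.simps
      by (intro recog_conj recog_disj recog_const recog_eq_const recog_eq recog_linear)
  next
    case Separator
    show ?thesis unfolding Letter Separator step_rel.simps
      by (intro recog_conj recog_disj recog_ball recog_all finite_lessThan recog_eq_const recog_eq
        recog_less)
  next
    case (State q)
    show ?thesis unfolding Letter State step_rel.simps
      by (intro recog_conj recog_ball recog_all finite_lessThan recog_eq_const recog_eq recog_eq_Suc
          recog_window_check recog_imp recog_ex recog_not recog_const)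
  qed
qed

section \<open>Parsing encoded instances\<close>

abbreviation push_bits :: "nat \<Rightarrow> bool list \<Rightarrow> nat" where
  "push_bits \<equiv> foldl (\<lambda>v b. 2 * v + of_bool b)"

text \<open>Shows that the partial values met while reading a number fit into the registers.\<close>

lemma push_bits_ge: "v \<le> push_bits v bs"
proof (induction bs arbitrary: v)
  case (Cons b bs)
  from Cons[of "2 * v + of_bool b"] show ?case by simp
qed simp

lemma binary_0: "binary 0 = [False]"
  by (simp add: binary.simps)

lemma binary_push_bits: "0 < v \<Longrightarrow> binary (push_bits v bs) = binary v @ bs"
proof (induction bs arbitrary: v)
  case (Cons b bs)
  have "binary (2 * v + of_bool b) = binary v @ [b]"
    using Cons.prems by (subst binary.simps) (auto simp: of_bool_def)
  then show ?case using Cons.IH[of "2 * v + of_bool b"] Cons.prems by simp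
qed simp

lemma binary_push_bits_1: "binary (push_bits 1 bs) = True # bs"
  using binary_push_bits[of 1 bs] by (simp add: binary.simps)

lemma ex_push_bits: "0 < n \<Longrightarrow> \<exists>bs. n = push_bits 1 bs"
proof (induction n rule: less_induct)
  case (less n)
  show ?case
  proof (cases "n = 1")
    case True
    then show ?thesis by (intro exI[of _ "[]"]) simp
  next
    case False
    then obtain bs where "n div 2 = push_bits 1 bs" using less.IH[of "n div 2"] less.prems by auto
    moreover have "n = 2 * (n div 2) + of_bool (odd n)" by (simp add: of_bool_def)
    ultimately show ?thesis by (intro exI[of _ "bs @ [odd n]"]) simp
  qed
qed

lemma chain_phase4:
  assumes "chain (step_rel F) (map Letter w @ [Right_End]) x y" "x Phase = 4"
  shows "\<exists>bs. w = map Bit bs \<and> x NumU = push_bits (x NumV) bs"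
  using assms
proof (induction w arbitrary: x)
  case (Cons a w)
  then obtain z where z: "step_rel F (Letter a) x z" "chain (step_rel F) (map Letter w @
    [Right_End]) z y" by auto
  then obtain b where a: "a = Bit b" using Cons.prems by (cases a) auto
  have "z Phase = 4" "z NumU = x NumU" "z NumV = 2 * x NumV + of_bool b" using z(1) Cons.prems a
    by auto
  moreover then obtain bs where "w = map Bit bs" "z NumU = push_bits (z NumV) bs" using Cons.IH
    z(2) by blast
  ultimately show ?case using a by (intro exI[of _ "b # bs"]) simp
qed auto

text \<open>A leading digit 0 occurs only in the notation of 0; hence phase 5 admits no further
  digit.\<close>

lemma chain_phase3:
  assumes "chain (step_rel F) (map Letter w @ [Right_End]) x y" "x Phase = 3"
  shows "w = map Bit (binary (x NumU))"
proof (cases w)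
  case Nil
  then show ?thesis using assms by auto
next
  case (Cons a w')
  then obtain z where z: "step_rel F (Letter a) x z" "chain (step_rel F) (map Letter w' @
    [Right_End]) z y"
    using assms by auto
  then obtain b where a: "a = Bit b" using assms(2) by (cases a) auto
  show ?thesis
  proof (cases b)
    case True
    then have "z Phase = 4" "z NumU = x NumU" "z NumV = 1" using z(1) assms(2) a by auto
    moreover then obtain bs where "w' = map Bit bs" "z NumU = push_bits (z NumV) bs" using
      chain_phase4 z(2) by blast
    ultimately show ?thesis using a True Cons binary_push_bits_1[of bs] by simp
  next
    case False
    then have ph: "z Phase = 5" "z NumU = x NumU" "z NumV = 0" using z(1) assms(2) a by auto
    have "w' = []"
    proof (rule ccontr)
      assume "w' \<noteq> []"
      then obtain a' w'' where "w' = a' # w''" by (cases w') auto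
      then obtain z' where "step_rel F (Letter a') z z'" using z(2) by auto
      then show False using ph(1) by (cases a') auto
    qed
    then have "x NumU = 0" using z(2) ph by auto
    then show ?thesis using a False Cons \<open>w' = []\<close> by (simp add: binary_0)
  qed
qed

text \<open>All intermediate assignments \<open>xs\<close> are returned, since every single window
  is needed to assemble a certificate.\<close>

lemma chain_phase2:
  assumes "chain (step_rel F) (map Letter w @ [Right_End]) x y" "x Phase = 2"
  shows "\<exists>qs w' xs z. w = map State qs @ Separator # w' \<and> xs 0 = x \<and>
    (\<forall>i<length qs. step_rel F (Letter (State (qs ! i))) (xs i) (xs (Suc i))) \<and> xs (length qs)
      Phase = 2 \<and>
    step_rel F (Letter Separator) (xs (length qs)) z \<and> chain (step_rel F) (map Letter w' @
      [Right_End]) z y"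
  using assms
proof (induction w arbitrary: x)
  case (Cons a w)
  then obtain z where z: "step_rel F (Letter a) x z" "chain (step_rel F) (map Letter w @
    [Right_End]) z y" by auto
  show ?case
  proof (cases a)
    case (Bit b)
    then show ?thesis using z(1) Cons.prems(2) by auto
  next
    case Separator
    then show ?thesis using z Cons.prems(2)
      by (intro exI[of _ "[]"] exI[of _ w] exI[of _ "\<lambda>_. x"] exI[of _ z]) simp
  next
    case (State q)
    then have "z Phase = 2" using z(1) by simp
    from Cons.IH[OF z(2) this] obtain qs w' xs z' where *: "w = map State qs @ Separator # w'" "xs
      0 = z"
      "\<forall>i<length qs. step_rel F (Letter (State (qs ! i))) (xs i) (xs (Suc i))" "xs (length qs)
        Phase = 2"
      "step_rel F (Letter Separator) (xs (length qs)) z'" "chain (step_rel F) (map Letter w' @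
        [Right_End]) z' y"
      by blast
    have "\<forall>i<length (q # qs). step_rel F (Letter (State ((q # qs) ! i)))
        (case_nat x xs i) (case_nat x xs (Suc i))"
    proof (intro allI impI)
      fix i assume "i < length (q # qs)"
      then show "step_rel F (Letter (State ((q # qs) ! i))) (case_nat x xs i) (case_nat x xs (Suc
        i))"
        using *(2,3) z(1) State by (cases i) (simp_all del: step_rel.simps)
    qed
    then show ?thesis using * State
      by (intro exI[of _ "q # qs"] exI[of _ w'] exI[of _ "case_nat x xs"] exI[of _ z'])
        (simp del: step_rel.simps)
  qed
qed auto

lemma chain_phase1:
  assumes "chain (step_rel F) (map Letter w @ [Right_End]) x y" "x Phase = 1"
  shows "\<exists>bs w' x' z. w = map Bit bs @ Separator # w' \<and> x' Phase = 1 \<and> x' NumN = push_bits (x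
    NumN) bs \<and>
    step_rel F (Letter Separator) x' z \<and> chain (step_rel F) (map Letter w' @ [Right_End]) z y"
  using assms
proof (induction w arbitrary: x)
  case (Cons a w)
  then obtain z where z: "step_rel F (Letter a) x z" "chain (step_rel F) (map Letter w @
    [Right_End]) z y" by auto
  show ?case
  proof (cases a)
    case (Bit b)
    then have ph: "z Phase = 1" "z NumN = 2 * x NumN + of_bool b" using z(1) Cons.prems(2) by auto
    from Cons.IH[OF z(2) ph(1)] obtain bs w' x' z' where "w = map Bit bs @ Separator # w'" "x'
      Phase = 1"
      "x' NumN = push_bits (z NumN) bs"
      "step_rel F (Letter Separator) x' z'" "chain (step_rel F) (map Letter w' @ [Right_End]) z'
        y" by blast
    then show ?thesis using Bit ph
      by (intro exI[of _ "b # bs"] exI[of _ w'] exI[of _ x'] exI[of _ z']) (simp del: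
        step_rel.simps)
  next
    case Separator
    then show ?thesis using z Cons.prems(2)
      by (intro exI[of _ "[]"] exI[of _ w] exI[of _ x] exI[of _ z]) (simp del: step_rel.simps)
  next
    case (State q)
    then show ?thesis using z(1) Cons.prems(2) by auto
  qed
qed auto

section \<open>From a register run to a certificate\<close>

lemma periodic_mod:
  fixes h :: "nat \<Rightarrow> 'b"
  assumes "\<And>j. j \<le> m \<Longrightarrow> h (n + j) = h j" "0 < n" "j \<le> n + m"
  shows "h j = h (j mod n)"
  using assms(3)
proof (induction j rule: less_induct)
  case (less j)
  show ?case
  proof (cases "j < n")
    case False
    then have "h j = h (j - n)" using assms(1)[of "j - n"] less.prems by simp
    also have "\<dots> = h ((j - n) mod n)" using less False assms(2) by (intro less.IH) auto
    also have "(j - n) mod n = j mod n" using False by (simp add: le_mod_geq)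
    finally show ?thesis .
  qed simp
qed

text \<open>Reconciles two numberings: the columns passing through the window start at its leftmost
  slot, \<open>r\<close> places before cell 0.\<close>

lemma cell_mod:
  assumes "0 < n"
  shows "(cell n r v d + r) mod n = (v + d) mod n"
proof -
  have "int ((cell n r v d + r) mod n) = ((int v + (int d - int r)) mod int n + int r) mod int n"
    using assms by (simp add: cell_def zmod_int)
  also have "\<dots> = (int v + int d) mod int n" by (simp add: mod_simps algebra_simps)
  finally show ?thesis by (metis of_nat_add of_nat_eq_iff zmod_int)
qed

lemma window_ok_cong:
  assumes "\<And>d. d < 2 * r + 1 \<Longrightarrow> B d = B' d \<and> P d = P' d \<and> I d = I' d"
  shows "window_ok f r q B P I \<longleftrightarrow> window_ok f r q B' P' I'"
proof -
  have "B r = B' r" "P r = P' r" "I r = I' r" using assms[of r] by auto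
  then show ?thesis using assms by (simp add: window_ok_def update_ok_def cong: conj_cong)
qed

lemma step_rel_sound:
  fixes F :: "'q::finite ca"
  assumes "chain (step_rel F) (symbols w) x0 y"
  shows "w \<in> AsyncUnstability F"
proof -
  define r where "r = radius F"
  obtain x1 where x1: "step_rel F Left_End x0 x1" "chain (step_rel F) (map Letter w @ [Right_End])
    x1 y"
    using assms by (auto simp: symbols_def)
  then have ph0: "x1 Phase = 0" by (simp add: regs_def)
  obtain a w1 where w: "w = a # w1" using x1(2) ph0 by (cases w) auto
  then obtain x2 where x2: "step_rel F (Letter a) x1 x2" "chain (step_rel F) (map Letter w1 @
    [Right_End]) x2 y"
    using x1 by auto
  \<comment> \<open>Phase 0 admits only the digit 1; \<open>n = 0\<close> is impossible anyway
    because \<open>u < n\<close>.\<close>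
  then have a: "a = Bit True" "x2 Phase = 1" "x2 NumN = 1" using ph0 by (cases a; auto)+
  obtain bs w2 x3 x4 where s3: "w1 = map Bit bs @ Separator # w2" "x3 Phase = 1" "x3 NumN =
    push_bits (x2 NumN) bs"
    "step_rel F (Letter Separator) x3 x4" "chain (step_rel F) (map Letter w2 @ [Right_End]) x4 y"
    using chain_phase1[OF x2(2) a(2)] by blast
  define n where "n = x4 NumN"
  define u where "u = x4 NumU"
  have x4: "x4 Phase = 2" "x4 NumN = x3 NumN" "x4 Idx = 0" "u < n"
    "\<And>d g. d < 2 * r + 1 \<Longrightarrow> x4 (Slot True d g) = x4 (Slot False d g)"
    using s3(2,4) by (auto simp: n_def u_def r_def)
  have bin_n: "binary n = True # bs" using x4(2) s3(3) a(3) binary_push_bits_1[of bs] by (simp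
    add: n_def)
  have n0: "0 < n" using x4(4) by simp
  obtain qs w3 xs x5 where s4: "w2 = map State qs @ Separator # w3" "xs 0 = x4"
    "\<And>i. i < length qs \<Longrightarrow> step_rel F (Letter (State (qs ! i))) (xs i) (xs (Suc i))" "xs (length qs)
      Phase = 2"
    "step_rel F (Letter Separator) (xs (length qs)) x5" "chain (step_rel F) (map Letter w3 @
      [Right_End]) x5 y"
    using chain_phase2[OF s3(5) x4(1)] by blast
  have inv: "xs i Idx = i \<and> xs i NumN = n \<and> xs i NumU = u \<and>
      (\<forall>d<2 * r + 1. \<forall>g. xs i (Slot True d g) = x4 (Slot False d g))" if "i \<le> length qs" for i
    using that
  proof (induction i)
    case 0
    then show ?case using x4(3,5) by (simp add: s4(2) n_def u_def)
  next
    case (Suc i)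
    then have "step_rel F (Letter (State (qs ! i))) (xs i) (xs (Suc i))" using s4(3) by simp
    then show ?case using Suc by (auto simp: r_def)
  qed
  have end5: "x5 Phase = 3" "x5 NumU = u" "xs (length qs) Idx = n"
    "\<And>d g. d < 2 * r + 1 \<Longrightarrow> xs (length qs) (Slot True d g) = xs (length qs) (Slot False d g)"
    using s4(4,5) inv[of "length qs"] by (auto simp: r_def)
  have len: "length qs = n" using inv[of "length qs"] end5(3) by simp
  have w3: "w3 = map Bit (binary u)" using chain_phase3[OF s4(6) end5(1)] end5(2) by simp
  have enc: "w = encode_instance n qs u"
    by (simp add: encode_instance_def w a s3(1) s4(1) w3 bin_n)
  \<comment> \<open>The windows unroll into one stream: window \<open>i\<close> shows the columns
    \<open>i\<close> to \<open>i + 2 * r\<close>. Columns beyond the first window are read when they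
    enter at slot \<open>2 * r\<close>.\<close>
  define h where "h j = (if j \<le> 2 * r then (\<lambda>g. xs 0 (Slot False j g)) else (\<lambda>g. xs (j - 2 * r)
    (Slot False (2 * r) g)))" for j
  have slots: "\<forall>d<2 * r + 1. \<forall>g. xs i (Slot False d g) = h (i + d) g" if "i \<le> n" for i
    using that
  proof (induction i)
    case 0
    then show ?case by (auto simp: h_def)
  next
    case (Suc i)
    then have st: "step_rel F (Letter (State (qs ! i))) (xs i) (xs (Suc i))" using s4(3) len by simp
    show ?case
    proof (intro allI impI)
      fix d g assume d: "d < 2 * r + 1"
      show "xs (Suc i) (Slot False d g) = h (Suc i + d) g"
      proof (cases "d = 2 * r")
        case True
        then show ?thesis by (simp add: h_def)
      next
        case False
        then have "xs (Suc i) (Slot False d g) = xs i (Slot False (Suc d) g)" using st d by (simp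
          add: r_def)
        also have "\<dots> = h (i + Suc d) g" using Suc False d by simp
        finally show ?thesis by simp
      qed
    qed
  qed
  \<comment> \<open>The second separator compares the last window with the saved first one.\<close>
  have wrap: "h (n + j) = h j" if "j \<le> 2 * r" for j
  proof
    fix g
    have j: "j < 2 * r + 1" using that by simp
    have "h (n + j) g = xs n (Slot False j g)" using slots[of n] j by simp
    also have "\<dots> = xs n (Slot True j g)" using end5(4)[OF j] len by simp
    also have "\<dots> = x4 (Slot False j g)" using inv[of n] len j by simp
    also have "\<dots> = h j g" using slots[of 0] j by (simp add: s4(2))
    finally show "h (n + j) g = h j g" .
  qed
  have per: "h j = h (j mod n)" if "j \<le> n + 2 * r" for j
    using wrap n0 that by (rule periodic_mod)
  define H where "H v = h (v + r)" for v
  have HH: "xs v (Slot False d g) = H (cell n r v d) g" if "v < n" "d < 2 * r + 1" for v d g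
  proof -
    have "xs v (Slot False d g) = h (v + d) g" using slots[of v] that by simp
    also have "h (v + d) = h ((v + d) mod n)" by (rule per, rule add_mono) (use that in simp_all)
    also have "\<dots> = h ((cell n r v d + r) mod n)" by (simp add: cell_mod[OF n0])
    also have "\<dots> = h (cell n r v d + r)" by (rule per[symmetric], rule add_mono) (use cell_less[OF
      n0, of r v d] in simp_all)
    finally show ?thesis by (simp add: H_def)
  qed
  define \<beta> where "\<beta> v q = H v (FB q)" for v q
  define \<pi> where "\<pi> v q = H v (FP q)" for v q
  \<comment> \<open>Guessed cell numbers are verified when the cell is the centre; periodicity
    carries this to all its other appearances.\<close>
  have idx: "H v FIdx = v" if "v < n" for v
    using s4(3)[of v] HH[OF that, of r FIdx] inv[of v] len that by (simp add: r_def cell_center)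
  have cert: "certificate F qs \<beta> \<pi>"
    unfolding certificate_def Let_def
  proof (intro allI impI)
    fix v assume "v < length qs"
    then have v: "v < n" by (simp add: len)
    have "window_ok (local_fun F) r (qs ! v) (\<lambda>d s. xs v (Slot False d (FB s))) (\<lambda>d s. xs v (Slot
      False d (FP s)))
       (\<lambda>d. xs v (Slot False d FIdx))"
      using s4(3)[of v] v len by (simp add: r_def window_check_iff)
    also have "?this \<longleftrightarrow> window_ok (local_fun F) r (qs ! v) (\<lambda>d. \<beta> (cell n r v d)) (\<lambda>d. \<pi> (cell n r
      v d)) (cell n r v)"
      using HH[OF v] idx[OF cell_less[OF n0]] by (intro window_ok_cong) (simp add: \<beta>_def \<pi>_def
        fun_eq_iff)
    finally show "window_ok (local_fun F) (radius F) (qs ! v) (\<lambda>d. \<beta> (cell (length qs) (radius F)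
      v d))
        (\<lambda>d. \<pi> (cell (length qs) (radius F) v d)) (cell (length qs) (radius F) v)"
      by (simp add: len r_def)
  qed
  have "\<exists>s. s \<noteq> qs ! u \<and> xs u (Slot False r (FB s)) \<noteq> 0"
    using s4(3)[of u] inv[of u] x4(4) len by (simp add: r_def)
  then obtain s where "s \<noteq> qs ! u" "\<beta> u s \<noteq> 0"
    using HH[OF x4(4), of r] x4(4) by (auto simp: \<beta>_def cell_center)
  then have "\<exists>\<sigma> T. sequential_scheme n \<sigma> \<and> T > 0 \<and> async_run F \<sigma> qs T ! u \<noteq> qs ! u"
    using certificate_sound[OF cert, of u s] x4(4) len by simp
  then show ?thesis unfolding AsyncUnstability_def using enc len x4(4) by blast
qed

section \<open>From a certificate to a register run\<close>

definition reg_conf :: "nat \<Rightarrow> nat \<Rightarrow> nat \<Rightarrow> nat \<Rightarrow> nat \<Rightarrow> nat \<Rightarrow> (nat \<Rightarrow> 'q slot_field \<Rightarrow> nat) \<Rightarrow> (nat \<Rightarrow>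
  'q slot_field \<Rightarrow> nat) \<Rightarrow> 'q reg \<Rightarrow> nat" where
  "reg_conf r ph N U V I ini cur v = (case v of Phase \<Rightarrow> ph | NumN \<Rightarrow> N | NumU \<Rightarrow> U | NumV \<Rightarrow> V | Idx
    \<Rightarrow> I
     | Slot c d g \<Rightarrow> if d < 2 * r + 1 then if c then ini d g else cur d g else 0)"

lemma reg_conf_simps [simp]:
  "reg_conf r ph N U V I ini cur Phase = ph"
  "reg_conf r ph N U V I ini cur NumN = N"
  "reg_conf r ph N U V I ini cur NumU = U"
  "reg_conf r ph N U V I ini cur NumV = V"
  "reg_conf r ph N U V I ini cur Idx = I"
  "d < 2 * r + 1 \<Longrightarrow> reg_conf r ph N U V I ini cur (Slot True d g) = ini d g"
  "d < 2 * r + 1 \<Longrightarrow> reg_conf r ph N U V I ini cur (Slot False d g) = cur d g"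
  by (simp_all add: reg_conf_def)

lemma bounded_reg_conf:
  assumes "ph < D ^ L" "N < D ^ L" "U < D ^ L" "V < D ^ L" "I < D ^ L"
    "\<And>d g. ini d g < D ^ L" "\<And>d g. cur d g < D ^ L"
  shows "bounded_regs D (regs r) L (reg_conf r ph N U V I ini cur)"
  unfolding bounded_regs_def
proof (intro allI conjI impI)
  fix v
  have "0 < D ^ L" using assms(1) by linarith
  then show "reg_conf r ph N U V I ini cur v < D ^ L"
    using assms by (cases v) (simp_all add: reg_conf_def)
  assume "v \<notin> regs r"
  then show "reg_conf r ph N U V I ini cur v = 0"
    by (cases v) (auto simp: regs_def reg_conf_def image_iff)
qed

lemma cell_Suc: "cell n r v (Suc d) = cell n r (Suc v) d"
  by (simp add: cell_def algebra_simps)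

lemma cell_wrap: "cell n r n d = cell n r 0 d"
  by (simp add: cell_def)

text \<open>The run is given explicitly. Registers that a clause leaves free are reset to 0 once
  they have served; \<open>5 < D ^ L\<close> makes room for the phase numbers.\<close>

lemma step_rel_complete:
  fixes F :: "'q::finite ca" and x :: "'q list"
  assumes cert: "certificate F x \<beta> \<pi>" and u: "u < length x" and s: "s \<noteq> x ! u" "\<beta> u s \<noteq> 0"
    and bound: "\<And>v q. v < length x \<Longrightarrow> \<beta> v q < D ^ L \<and> \<pi> v q < D ^ L" and L: "length x < D ^ L" "5 <
      D ^ L"
  shows "\<exists>x0 y. chain (\<lambda>a x y. bounded_regs D (regs (radius F)) L y \<and> step_rel F a x y)
    (symbols (encode_instance (length x) x u)) x0 y"
proof -
  define n where "n = length x"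
  define r where "r = radius F"
  let ?R = "\<lambda>a x y. bounded_regs D (regs (radius F)) L y \<and> step_rel F a x y"
  have n0: "0 < n" and un: "u < n" and nL: "n < D ^ L" using u L unfolding n_def by linarith+
  define hist where "hist v g = (case g of FIdx \<Rightarrow> v | FB q \<Rightarrow> \<beta> v q | FP q \<Rightarrow> \<pi> v q)" for v and g ::
    "'q slot_field"
  define W where "W i d g = hist (cell n r i d) g" for i d g
  have hist: "hist v FIdx = v" "hist v (FB q) = \<beta> v q" "hist v (FP q) = \<pi> v q" for v q by
    (simp_all add: hist_def)
  have W_less: "W i d g < D ^ L" for i d g
    using bound[of "cell n r i d"] cell_less[OF n0, of r i d] nL
    unfolding W_def n_def[symmetric] by (cases g) (auto simp: hist)
  let ?z = "\<lambda>_ _. 0 :: nat"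
  note bnd = bounded_reg_conf[of _ D L _ _ _ _ _ _ r, folded r_def]
  have L0: "0 < D ^ L" "1 < D ^ L" "2 < D ^ L" "3 < D ^ L" "4 < D ^ L" using L(2) by linarith+
  have bits_n: "chain ?R (map Letter (map Bit bs)) (reg_conf r 1 N 0 0 0 ?z ?z) (reg_conf r 1
    (push_bits N bs) 0 0 0 ?z ?z)"
    if "push_bits N bs < D ^ L" for N bs
    using that
  proof (induction bs arbitrary: N)
    case (Cons b bs)
    have "push_bits (2 * N + of_bool b) bs < D ^ L" using Cons.prems by simp
    moreover from this have "2 * N + of_bool b < D ^ L" using push_bits_ge order_le_less_trans by
      blast
    ultimately show ?case using Cons.IH[of "2 * N + of_bool b"] L0
      by (auto simp: r_def[symmetric] intro!: exI[of _ "reg_conf r 1 (2 * N + of_bool b) 0 0 0 ?z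
        ?z"] bnd)
  qed simp
  have bits_u: "chain ?R (map Letter (map Bit bs)) (reg_conf r 4 0 u V 0 ?z ?z) (reg_conf r 4 0 u
    (push_bits V bs) 0 ?z ?z)"
    if "push_bits V bs < D ^ L" for V bs
    using that
  proof (induction bs arbitrary: V)
    case (Cons b bs)
    have "push_bits (2 * V + of_bool b) bs < D ^ L" using Cons.prems by simp
    moreover from this have "2 * V + of_bool b < D ^ L" using push_bits_ge order_le_less_trans by
      blast
    ultimately show ?case using Cons.IH[of "2 * V + of_bool b"] L0 un nL
      by (auto simp: r_def[symmetric] intro!: exI[of _ "reg_conf r 4 0 u (2 * V + of_bool b) 0 ?z
        ?z"] bnd)
  qed simp
  let ?S = "\<lambda>i. reg_conf r 2 n u 0 i (W 0) (W i)"
  have state_step: "?R (Letter (State (x ! i))) (?S i) (?S (Suc i))" if i: "i < n" for i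
  proof
    show "bounded_regs D (regs (radius F)) L (?S (Suc i))"
      unfolding r_def[symmetric] using W_less i nL un L0 by (intro bnd) auto
    have rr: "r < 2 * r + 1" by simp
    have center: "?S i (Slot False r g) = hist i g" for g
      unfolding reg_conf_simps(7)[OF rr] W_def using i by (simp add: cell_center)
    have "window_ok (local_fun F) r (x ! i) (\<lambda>d. \<beta> (cell n r i d)) (\<lambda>d. \<pi> (cell n r i d)) (cell n
      r i)"
      using cert i by (simp add: certificate_def Let_def n_def r_def)
    moreover have "window_ok (local_fun F) r (x ! i) (\<lambda>d s. ?S i (Slot False d (FB s)))
        (\<lambda>d s. ?S i (Slot False d (FP s))) (\<lambda>d. ?S i (Slot False d FIdx)) \<longleftrightarrow>
      window_ok (local_fun F) r (x ! i) (\<lambda>d. \<beta> (cell n r i d)) (\<lambda>d. \<pi> (cell n r i d)) (cell n r i)"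
      by (rule window_ok_cong) (simp add: W_def hist)
    ultimately have win: "window_check (local_fun F) r (x ! i) (\<lambda>d s. ?S i (Slot False d (FB s)))
        (\<lambda>d s. ?S i (Slot False d (FP s))) (\<lambda>d. ?S i (Slot False d FIdx))"
      unfolding window_check_iff by blast
    have "\<exists>s. s \<noteq> x ! i \<and> \<not> ?S i (Slot False r (FB s)) = 0" if "u = i"
      unfolding center hist using s that by blast
    moreover have "?S (Suc i) (Slot False d g) = ?S i (Slot False (Suc d) g)" if "d < 2 * r" for d g
      using that by (simp add: W_def cell_Suc)
    ultimately show "step_rel F (Letter (State (x ! i))) (?S i) (?S (Suc i))"
      unfolding step_rel.simps r_def[symmetric] using win center[of FIdx] by (simp add: hist)
  qed
  have states: "chain ?R (map Letter (map State (take k x))) (?S 0) (?S k)" if "k \<le> n" for k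
    using that
  proof (induction k)
    case (Suc k)
    have *: "map Letter (map State (take (Suc k) x)) = map Letter (map State (take k x)) @ [Letter
      (State (x ! k))]"
      using Suc.prems by (simp add: take_Suc_conv_app_nth n_def)
    have "chain ?R (map Letter (map State (take k x))) (?S 0) (?S k)" using Suc by simp
    moreover have "?R (Letter (State (x ! k))) (?S k) (?S (Suc k))" using state_step Suc.prems by
      simp
    ultimately show ?case unfolding * chain_append chain.simps by blast
  qed simp
  obtain bs where bs: "n = push_bits 1 bs" using ex_push_bits[OF n0] by blast
  have bin_n: "binary n = True # bs" unfolding bs by (rule binary_push_bits_1)
  let ?c0 = "reg_conf r 0 0 0 0 0 ?z ?z"
  have "bounded_regs D (regs r) L ?c0" using L0 by (intro bnd) simp_all
  moreover have "?c0 v = 0" for v :: "'q reg" by (cases v) (simp_all add: reg_conf_def)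
  ultimately have "?R Left_End ?c0 ?c0" by (simp add: r_def)
  moreover have "?R (Letter (Bit True)) ?c0 (reg_conf r 1 1 0 0 0 ?z ?z)"
    using L0 by (auto simp: r_def[symmetric] intro!: bnd)
  moreover have "chain ?R (map Letter (map Bit bs)) (reg_conf r 1 1 0 0 0 ?z ?z) (reg_conf r 1 n 0
    0 0 ?z ?z)"
    using bits_n[of 1 bs] nL bs by simp
  moreover have "?R (Letter Separator) (reg_conf r 1 n 0 0 0 ?z ?z) (?S 0)"
    using L0 nL un W_less by (auto simp: r_def[symmetric] intro!: bnd)
  moreover have "chain ?R (map Letter (map State x)) (?S 0) (?S n)" using states[of n] by (simp
    add: n_def)
  \<comment> \<open>Windows \<open>n\<close> and 0 agree by \<open>cell_wrap\<close>, so the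
    comparison closing the cycle succeeds.\<close>
  moreover have "?R (Letter Separator) (?S n) (reg_conf r 3 0 u 0 0 ?z ?z)"
    using L0 nL un by (auto simp: r_def[symmetric] W_def cell_wrap intro!: bnd)
  moreover have "\<exists>y. chain ?R (map Letter (map Bit (binary u)) @ [Right_End]) (reg_conf r 3 0 u 0
    0 ?z ?z) y"
  proof (cases "u = 0")
    case True
    have "?R (Letter (Bit False)) (reg_conf r 3 0 u 0 0 ?z ?z) (reg_conf r 5 0 u 0 0 ?z ?z)"
      using L0 L(2) un nL by (auto simp: r_def[symmetric] intro!: bnd)
    moreover have "?R Right_End (reg_conf r 5 0 u 0 0 ?z ?z) ?c0"
      using L0 True by (auto simp: r_def[symmetric] intro!: bnd)
    ultimately show ?thesis unfolding True binary_0 list.map append.simps chain.simps by blast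
  next
    case False
    then obtain cs where cs: "u = push_bits 1 cs" using ex_push_bits by blast
    have bin_u: "binary u = True # cs" unfolding cs by (rule binary_push_bits_1)
    have "?R (Letter (Bit True)) (reg_conf r 3 0 u 0 0 ?z ?z) (reg_conf r 4 0 u 1 0 ?z ?z)"
      using L0 un nL by (auto simp: r_def[symmetric] intro!: bnd)
    moreover have "chain ?R (map Letter (map Bit cs)) (reg_conf r 4 0 u 1 0 ?z ?z) (reg_conf r 4 0
      u u 0 ?z ?z)"
      using bits_u[of 1 cs] un nL cs by simp
    moreover have "?R Right_End (reg_conf r 4 0 u u 0 ?z ?z) ?c0"
      using L0 by (auto simp: r_def[symmetric] intro!: bnd)
    ultimately show ?thesis unfolding bin_u list.map append.simps chain.simps chain_append by blast
  qed
  then obtain y where "chain ?R (map Letter (map Bit (binary u)) @ [Right_End]) (reg_conf r 3 0 u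
    0 0 ?z ?z) y" by blast
  ultimately have "chain ?R ((Left_End # Letter (Bit True) # map Letter (map Bit bs)) @ Letter
    Separator #
      map Letter (map State x) @ Letter Separator # map Letter (map Bit (binary u)) @ [Right_End])
        ?c0 y"
    unfolding append.simps chain.simps chain_append by blast
  moreover have "symbols (encode_instance (length x) x u) =
      (Left_End # Letter (Bit True) # map Letter (map Bit bs)) @ Letter Separator #
      map Letter (map State x) @ Letter Separator # map Letter (map Bit (binary u)) @ [Right_End]"
    using bin_n by (simp add: symbols_def encode_instance_def n_def)
  ultimately show ?thesis by metis
qed

lemma length_binary_pos: "0 < length (binary n)"
  by (subst binary.simps) simp

theorem theorem1:
  fixes F :: "'q::finite ca"
  assumes "freezing F"
  shows "AsyncUnstability F \<in> NL"
proof -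
  define K where "K = card (UNIV :: 'q set)"
  \<comment> \<open>Block numbers reach \<open>n * K\<close>, while the word length only guarantees
    \<open>n + 4 < 2 ^ L\<close>. The factor \<open>K\<close> in the base supplies
    \<open>K ^ L\<close>, which is at least the missing \<open>K\<close>.\<close>
  define D where "D = 2 * K"
  have K: "1 \<le> K" unfolding K_def by (simp add: Suc_le_eq card_gt_0_iff)
  then have D: "2 \<le> D" by (simp add: D_def)
  let ?R = "\<lambda>w a x y. bounded_regs D (regs (radius F)) (length (counter (length w))) y \<and> step_rel
    F a x y"
  have "w \<in> AsyncUnstability F \<longleftrightarrow> (\<exists>x y. chain (?R w) (symbols w) x y)" for w :: "'q symbol list"
  proof
    assume "\<exists>x y. chain (?R w) (symbols w) x y"
    then obtain x y where "chain (?R w) (symbols w) x y" by blast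
    moreover have "chain (?R w) as x y \<Longrightarrow> chain (step_rel F) as x y" for as x y
      by (induction as arbitrary: x) auto
    ultimately show "w \<in> AsyncUnstability F" using step_rel_sound by blast
  next
    assume "w \<in> AsyncUnstability F"
    then obtain x u \<sigma> T where w: "w = encode_instance (length x) x u" and u: "u < length x"
      and run: "sequential_scheme (length x) \<sigma>" "async_run F \<sigma> x T ! u \<noteq> x ! u"
      unfolding AsyncUnstability_def by blast
    obtain \<beta> \<pi> s where cert: "certificate F x \<beta> \<pi>" and s: "s \<noteq> x ! u" "\<beta> u s \<noteq> 0"
      and bound: "\<And>v q. v < length x \<Longrightarrow> \<beta> v q \<le> length x * K \<and> \<pi> v q \<le> length x"
      using certificate_complete[OF assms run(1) u run(2)] unfolding K_def by blast
    define L where "L = length (counter (length w))"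
    have "length w = length (binary (length x)) + length x + length (binary u) + 2"
      by (simp add: w encode_instance_def)
    \<comment> \<open>Two separators and at least one digit for each number; as \<open>n\<close> is
      positive, this also gives \<open>5 < D ^ L\<close>.\<close>
    then have "length x + 4 \<le> length w"
      using length_binary_pos[of "length x"] length_binary_pos[of u] by linarith
    then have len: "length x + 4 < 2 ^ L"
      using less_power_length_counter[of "length w"] unfolding L_def by linarith
    then have L: "1 \<le> L" by (cases L) auto
    have "(length x + 4) * K < 2 ^ L * K" using len K by (intro mult_strict_right_mono) auto
    also have "\<dots> \<le> 2 ^ L * K ^ L" using K L by (intro mult_le_mono2 self_le_power) auto
    also have "\<dots> = D ^ L" by (simp add: D_def power_mult_distrib)
    finally have 1: "(length x + 4) * K < D ^ L" .
    have 2: "length x + 4 \<le> (length x + 4) * K" using K by simp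
    have 3: "length x * K \<le> (length x + 4) * K" by simp
    have "\<exists>x0 y. chain (\<lambda>a x y. bounded_regs D (regs (radius F)) L y \<and> step_rel F a x y)
        (symbols (encode_instance (length x) x u)) x0 y"
      using cert u s
    proof (rule step_rel_complete)
      show "\<beta> v q < D ^ L \<and> \<pi> v q < D ^ L" if "v < length x" for v q
        using bound[OF that, of q] 1 2 3 by linarith
      show "length x < D ^ L" "5 < D ^ L" using 1 2 u by linarith+
    qed
    then show "\<exists>x y. chain (?R w) (symbols w) x y" unfolding L_def w by simp
  qed
  then have "AsyncUnstability F = {w. \<exists>x y. chain (?R w) (symbols w) x y}" by blast
  also have "\<dots> \<in> NL"
    using D finite_regs recog_step_rel by (rule register_language_in_NL) simp
  finally show ?thesis .
qed

end
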